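(* Let $V$ be a vector space over $\mathbb{C}$ equipped with a linear map $Y$ from $V$ to $\operatorname{Hom}(V,V((x)))$, a distinguished vector $\mathbf 1\in V$ and a linear operator $\mathcal{D}$ on $V$ such that $$\mathcal{D}(\mathbf 1)=0,\qquad Y(\mathbf 1,x)=1,$$ $$Y(v,x)\mathbf 1\in V[[x]]\ \text{ and }\ \lim_{x\to 0}Y(v,x)\mathbf 1=v,\qquad [\mathcal{D},Y(v,x)]=\frac{d}{dx}Y(v,x)$$ for all $v\in V$, and such that for any $u,v\in V$ there exists a nonzero polynomial $f(x_1,x_2)\in\mathbb{C}[x_1,x_2]$ such that $$f(x_1,x_2)Y(u,x_1)Y(v,x_2)=f(x_1,x_2)Y(v,x_2)Y(u,x_1).$$ Then $(V,Y,\mathbf 1)$ is an (ordinary) vertex algebra.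
   Context: $x,x_0,x_1,x_2$ are commuting formal variables and $V((x))$ is the space of lower truncated Laurent series with coefficients in $V$. $\delta(z)=\sum_{n\in\mathbb{Z}}z^n$; integer powers of a binomial are expanded in nonnegative powers of the second-written term. A vertex algebra is a triple $(V,Y,\mathbf 1)$ with $Y:V\to\operatorname{Hom}(V,V((x)))$ linear satisfying $Y(\mathbf 1,x)=1$, $Y(v,x)\mathbf 1\in V[[x]]$ with $\lim_{x\to0}Y(v,x)\mathbf 1=v$ for all $v$, and, for all $u,v\in V$, the Jacobi identity $$x_0^{-1}\delta\left(\tfrac{x_1-x_2}{x_0}\right)Y(u,x_1)Y(v,x_2)-x_0^{-1}\delta\left(\tfrac{x_2-x_1}{-x_0}\right)Y(v,x_2)Y(u,x_1)=x_2^{-1}\delta\left(\tfrac{x_1-x_0}{x_2}\right)Y(Y(u,x_0)v,x_2).$$ *)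

theory Defs
  imports
    "HOL-Computational_Algebra.Computational_Algebra"
    "HOL-Library.Groups_Big_Fun"
    "HOL-Library.Product_Plus"
begin

unbundle fps_syntax

section \<open>Laurent series with coefficients in a vector space\<close>

text \<open>
  The space \<open>V((x))\<close> is the library type \<open>'v fls\<close>. Its ring and derivative operations
  require a ring of coefficients, so the operations that only need a module of coefficients are
  introduced here. All of them are coefficientwise; \<open>fls_map\<close> is meant for maps with
  \<open>g 0 = 0\<close>, which covers every use below.
\<close>

definition fls_map :: "('v::zero \<Rightarrow> 'w::zero) \<Rightarrow> 'v fls \<Rightarrow> 'w fls" where
  "fls_map g F = Abs_fls (\<lambda>n. g (F $$ n))"

definition fls_scale :: "(complex \<Rightarrow> 'v \<Rightarrow> 'v) \<Rightarrow> complex \<Rightarrow> 'v::zero fls \<Rightarrow> 'v fls" where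
  "fls_scale scale c = fls_map (scale c)"

definition fls_ddx :: "(complex \<Rightarrow> 'v \<Rightarrow> 'v) \<Rightarrow> 'v::zero fls \<Rightarrow> 'v fls" where
  "fls_ddx scale F = Abs_fls (\<lambda>n. scale (of_int (n + 1)) (F $$ (n + 1)))"

lemma fls_map_nth [simp]:
  assumes "g 0 = 0"
  shows "fls_map g F $$ n = g (F $$ n)"
proof -
  obtain N where "\<forall>n<N. F $$ n = 0"
    by (rule fls_nth_vanishes_belowE)
  then show ?thesis
    unfolding fls_map_def using assms by (intro nth_Abs_fls_ex_lower_bound exI[of _ N]) simp
qed

lemma fls_scale_nth [simp]:
  assumes "vector_space scale"
  shows "fls_scale scale c F $$ n = scale c (F $$ n)"
proof -
  interpret vector_space scale by fact
  show ?thesis by (simp add: fls_scale_def)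
qed

lemma fls_ddx_nth [simp]:
  assumes "vector_space scale"
  shows "fls_ddx scale F $$ n = scale (of_int (n + 1)) (F $$ (n + 1))"
proof -
  interpret vector_space scale by fact
  obtain N where "\<forall>n<N. F $$ n = 0"
    by (rule fls_nth_vanishes_belowE)
  then show ?thesis
    unfolding fls_ddx_def by (intro nth_Abs_fls_ex_lower_bound exI[of _ "N - 1"]) simp
qed

lemma vector_space_fls_scale:
  assumes "vector_space scale"
  shows "vector_space (fls_scale scale)"
proof -
  interpret vector_space scale by fact
  show ?thesis
    by unfold_locales (simp_all add: fls_eq_iff assms scale_right_distrib scale_left_distrib)
qed


section \<open>Formal distributions\<close>

text \<open>
  A doubly infinite formal series in several commuting variables is its coefficient function on
  exponent vectors: \<open>A (m, n)\<close> is the coefficient of \<open>x\<^sub>1\<^sup>m x\<^sub>2\<^sup>n\<close>, and \<open>A (a, b, c)\<close> that of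
  \<open>x\<^sub>0\<^sup>a x\<^sub>1\<^sup>b x\<^sub>2\<^sup>c\<close>. The product of a scalar series and a \<open>V\<close>-valued series is formed
  only when each coefficient is a sum with finitely many nonzero terms (\<open>Sum_any\<close> is a junk \<open>0\<close>
  otherwise); the lemmas \<open>finite_\<dots>\<close> below show that this holds for all products used.
\<close>

definition series_mult ::
    "(complex \<Rightarrow> 'v \<Rightarrow> 'v) \<Rightarrow> ('e \<Rightarrow> complex) \<Rightarrow> ('e \<Rightarrow> 'v) \<Rightarrow> 'e::ab_group_add \<Rightarrow> 'v::ab_group_add"
  where "series_mult scale f A e = Sum_any (\<lambda>d. scale (f d) (A (e - d)))"

text \<open>
  \<open>\<complex>[x\<^sub>1, x\<^sub>2]\<close> is read as \<open>\<complex>[x\<^sub>1][x\<^sub>2]\<close>: the outer polynomial variable is \<open>x\<^sub>2\<close>.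
\<close>

definition poly2_series :: "complex poly poly \<Rightarrow> int \<times> int \<Rightarrow> complex" where
  "poly2_series f = (\<lambda>(i, j).
     if 0 \<le> i \<and> 0 \<le> j then coeff (coeff f (nat j)) (nat i) else 0)"

text \<open>
  The coefficient of \<open>y\<^sup>i z\<^sup>j\<close> in \<open>(y - z)\<^sup>n\<close>, for any integer \<open>n\<close>, expanded in nonnegative
  powers of \<open>z\<close>.
\<close>

definition binom_coeff :: "int \<Rightarrow> int \<Rightarrow> int \<Rightarrow> complex" where
  "binom_coeff n i j =
     (if 0 \<le> j \<and> i + j = n then (- 1) ^ nat j * (of_int n gchoose nat j) else 0)"

text \<open>
  The three delta series, with \<open>\<delta>(z) = \<Sum>n. z\<^sup>n\<close>. In the first, for instance, the summand
  \<open>x\<^sub>0\<^sup>-\<^sup>1 (x\<^sub>1 - x\<^sub>2)\<^sup>n x\<^sub>0\<^sup>-\<^sup>n\<close> is the only one containing \<open>x\<^sub>0\<^sup>a\<close> with \<open>a = - n - 1\<close>.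
\<close>

text \<open>\<open>x\<^sub>0\<^sup>-\<^sup>1 \<delta>((x\<^sub>1 - x\<^sub>2) / x\<^sub>0)\<close>\<close>

definition delta_12_0 :: "int \<times> int \<times> int \<Rightarrow> complex" where
  "delta_12_0 = (\<lambda>(a, b, c). binom_coeff (- a - 1) b c)"

text \<open>\<open>x\<^sub>0\<^sup>-\<^sup>1 \<delta>((x\<^sub>2 - x\<^sub>1) / (- x\<^sub>0))\<close>; the sign is that of \<open>(- x\<^sub>0)\<^sup>-\<^sup>n\<close>.\<close>

definition delta_21_0 :: "int \<times> int \<times> int \<Rightarrow> complex" where
  "delta_21_0 = (\<lambda>(a, b, c). (- 1) powi (- a - 1) * binom_coeff (- a - 1) c b)"

text \<open>\<open>x\<^sub>2\<^sup>-\<^sup>1 \<delta>((x\<^sub>1 - x\<^sub>0) / x\<^sub>2)\<close>\<close>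

definition delta_10_2 :: "int \<times> int \<times> int \<Rightarrow> complex" where
  "delta_10_2 = (\<lambda>(a, b, c). binom_coeff (- c - 1) b a)"


section \<open>Compositions of vertex operators\<close>

text \<open>
  \<open>Y u v\<close> is the series \<open>Y(u, x)v\<close>, so \<open>Y u v $$ n\<close> is the coefficient of \<open>x\<^sup>n\<close> (that is,
  \<open>u\<^sub>-\<^sub>n\<^sub>-\<^sub>1 v\<close> in mode notation). The following three are the series
  \<open>Y(u, x\<^sub>1) Y(v, x\<^sub>2) w\<close>, \<open>Y(v, x\<^sub>2) Y(u, x\<^sub>1) w\<close> and \<open>Y(Y(u, x\<^sub>0)v, x\<^sub>2) w\<close>, the last one with
  coefficients indexed by the exponents of \<open>(x\<^sub>0, x\<^sub>2)\<close>.
\<close>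

definition prod_12 :: "('v \<Rightarrow> 'v \<Rightarrow> 'v fls) \<Rightarrow> 'v \<Rightarrow> 'v \<Rightarrow> 'v \<Rightarrow> int \<times> int \<Rightarrow> 'v::ab_group_add" where
  "prod_12 Y u v w = (\<lambda>(m, n). Y u (Y v w $$ n) $$ m)"

definition prod_21 :: "('v \<Rightarrow> 'v \<Rightarrow> 'v fls) \<Rightarrow> 'v \<Rightarrow> 'v \<Rightarrow> 'v \<Rightarrow> int \<times> int \<Rightarrow> 'v::ab_group_add" where
  "prod_21 Y u v w = (\<lambda>(m, n). Y v (Y u w $$ m) $$ n)"

definition iter_02 :: "('v \<Rightarrow> 'v \<Rightarrow> 'v fls) \<Rightarrow> 'v \<Rightarrow> 'v \<Rightarrow> 'v \<Rightarrow> int \<times> int \<Rightarrow> 'v::ab_group_add" where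
  "iter_02 Y u v w = (\<lambda>(a, c). Y (Y u v $$ a) w $$ c)"

text \<open>A series in \<open>x\<^sub>1, x\<^sub>2\<close> (respectively \<open>x\<^sub>0, x\<^sub>2\<close>) regarded as one in \<open>x\<^sub>0, x\<^sub>1, x\<^sub>2\<close>.\<close>

definition in_12 :: "(int \<times> int \<Rightarrow> 'v) \<Rightarrow> int \<times> int \<times> int \<Rightarrow> 'v::zero" where
  "in_12 A = (\<lambda>(a, b, c). if a = 0 then A (b, c) else 0)"

definition in_02 :: "(int \<times> int \<Rightarrow> 'v) \<Rightarrow> int \<times> int \<times> int \<Rightarrow> 'v::zero" where
  "in_02 A = (\<lambda>(a, b, c). if b = 0 then A (a, c) else 0)"


section \<open>Vertex algebras\<close>

text \<open>
  The complex vector space \<open>V\<close> is the whole type \<open>'v\<close> with scalar multiplication \<open>scale\<close>. The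
  first assumption below says that each \<open>Y u\<close> lies in \<open>Hom(V, V((x)))\<close>, the second that
  \<open>Y\<close> is itself linear (the vector space structure of \<open>Hom\<close> being pointwise).
\<close>

locale vertex_operator_map = vector_space scale
  for scale :: "complex \<Rightarrow> 'v::ab_group_add \<Rightarrow> 'v" +
  fixes Y :: "'v \<Rightarrow> 'v \<Rightarrow> 'v fls"
  assumes Y_hom: "\<And>u. Vector_Spaces.linear scale (fls_scale scale) (Y u)"
    and Y_linear: "\<And>v. Vector_Spaces.linear scale (fls_scale scale) (\<lambda>u. Y u v)"

locale vertex_algebra = vertex_operator_map scale Y
  for scale :: "complex \<Rightarrow> 'v::ab_group_add \<Rightarrow> 'v"
    and Y :: "'v \<Rightarrow> 'v \<Rightarrow> 'v fls" +
  fixes vac :: 'v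
  assumes vacuum: "\<And>w. Y vac w = fls_const w"
    and creation: "\<And>v. Y v vac \<in> range fps_to_fls"
    and creation_limit: "\<And>v. Y v vac $$ 0 = v"
    and jacobi: "\<And>u v w e.
        series_mult scale delta_12_0 (in_12 (prod_12 Y u v w)) e
      - series_mult scale delta_21_0 (in_12 (prod_21 Y u v w)) e
      = series_mult scale delta_10_2 (in_02 (iter_02 Y u v w)) e"

context vertex_operator_map
begin

lemma Y_zero [simp]: "Y u 0 = 0" "Y 0 v = 0"
proof -
  interpret a: Vector_Spaces.linear scale "fls_scale scale" "Y u" by (rule Y_hom)
  interpret b: Vector_Spaces.linear scale "fls_scale scale" "\<lambda>u. Y u v" by (rule Y_linear)
  show "Y u 0 = 0" "Y 0 v = 0" by (rule a.zero, rule b.zero)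
qed

lemma finite_poly2_mult:
  "finite {d. scale (poly2_series f d) (A (e - d)) \<noteq> 0}"
proof (rule finite_subset)
  let ?B = "(\<Union>j\<le>degree f. (\<lambda>i. (int i, int j)) ` {..degree (coeff f j)})"
  show "{d. scale (poly2_series f d) (A (e - d)) \<noteq> 0} \<subseteq> ?B"
  proof
    fix d assume d: "d \<in> {d. scale (poly2_series f d) (A (e - d)) \<noteq> 0}"
    obtain i j where ij: "d = (i, j)" by (cases d)
    with d have nz: "0 \<le> i" "0 \<le> j" "coeff (coeff f (nat j)) (nat i) \<noteq> 0"
      by (auto simp: poly2_series_def split: if_splits)
    then have "nat i \<le> degree (coeff f (nat j))" by (intro le_degree)
    moreover have "nat j \<le> degree f" using nz(3) by (intro le_degree) auto
    ultimately show "d \<in> ?B" using nz ij by force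
  qed
qed auto

lemma finite_delta_12_0_mult:
  "finite {d. scale (delta_12_0 d) (in_12 (prod_12 Y u v w) (e - d)) \<noteq> 0}"
proof -
  obtain a b c where e: "e = (a, b, c)" by (cases e)
  obtain N where N: "\<forall>n<N. Y v w $$ n = 0" by (rule fls_nth_vanishes_belowE)
  have "{d. scale (delta_12_0 d) (in_12 (prod_12 Y u v w) (e - d)) \<noteq> 0}
      \<subseteq> (\<lambda>k. (a, - a - 1 - k, k)) ` {0..c - N}"
  proof
    fix d assume d: "d \<in> {d. scale (delta_12_0 d) (in_12 (prod_12 Y u v w) (e - d)) \<noteq> 0}"
    obtain i j k where ijk: "d = (i, j, k)" by (cases d)
    have "\<not> c - k < N" "i = a" "0 \<le> k" "j + k = - i - 1"
      using d N by (auto simp: ijk e delta_12_0_def in_12_def prod_12_def binom_coeff_def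
          minus_prod_def split: if_splits)
    then show "d \<in> (\<lambda>k. (a, - a - 1 - k, k)) ` {0..c - N}"
      by (intro image_eqI[of _ _ k]) (auto simp: ijk)
  qed
  then show ?thesis by (rule finite_subset) simp
qed

lemma finite_delta_21_0_mult:
  "finite {d. scale (delta_21_0 d) (in_12 (prod_21 Y u v w) (e - d)) \<noteq> 0}"
proof -
  obtain a b c where e: "e = (a, b, c)" by (cases e)
  obtain N where N: "\<forall>n<N. Y u w $$ n = 0" by (rule fls_nth_vanishes_belowE)
  have "{d. scale (delta_21_0 d) (in_12 (prod_21 Y u v w) (e - d)) \<noteq> 0}
      \<subseteq> (\<lambda>k. (a, k, - a - 1 - k)) ` {0..b - N}"
  proof
    fix d assume d: "d \<in> {d. scale (delta_21_0 d) (in_12 (prod_21 Y u v w) (e - d)) \<noteq> 0}"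
    obtain i j k where ijk: "d = (i, j, k)" by (cases d)
    have "\<not> b - j < N" "i = a" "0 \<le> j" "k + j = - i - 1"
      using d N by (auto simp: ijk e delta_21_0_def in_12_def prod_21_def binom_coeff_def
          minus_prod_def split: if_splits)
    then show "d \<in> (\<lambda>k. (a, k, - a - 1 - k)) ` {0..b - N}"
      by (intro image_eqI[of _ _ j]) (auto simp: ijk)
  qed
  then show ?thesis by (rule finite_subset) simp
qed

lemma finite_delta_10_2_mult:
  "finite {d. scale (delta_10_2 d) (in_02 (iter_02 Y u v w) (e - d)) \<noteq> 0}"
proof -
  obtain a b c where e: "e = (a, b, c)" by (cases e)
  obtain N where N: "\<forall>n<N. Y u v $$ n = 0" by (rule fls_nth_vanishes_belowE)
  have "{d. scale (delta_10_2 d) (in_02 (iter_02 Y u v w) (e - d)) \<noteq> 0}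
      \<subseteq> (\<lambda>k. (k, b, - b - k - 1)) ` {0..a - N}"
  proof
    fix d assume d: "d \<in> {d. scale (delta_10_2 d) (in_02 (iter_02 Y u v w) (e - d)) \<noteq> 0}"
    obtain i j k where ijk: "d = (i, j, k)" by (cases d)
    have "\<not> a - i < N" "j = b" "0 \<le> i" "j + i = - k - 1"
      using d N by (auto simp: ijk e delta_10_2_def in_02_def iter_02_def binom_coeff_def
          minus_prod_def split: if_splits)
    then show "d \<in> (\<lambda>k. (k, b, - b - k - 1)) ` {0..a - N}"
      by (intro image_eqI[of _ _ i]) (auto simp: ijk)
  qed
  then show ?thesis by (rule finite_subset) simp
qed

end

end

theory Submission
  imports Defs
begin

text \<open>
  Let \<open>C = [Y(u, x\<^sub>1), Y(v, x\<^sub>2)]\<close>. The bracket with \<open>D\<close> acts on \<open>C\<close> as \<open>\<partial>\<^sub>1 + \<partial>\<^sub>2\<close>, so the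
  polynomials annihilating \<open>C\<close> are stable under \<open>\<partial>\<^sub>1 + \<partial>\<^sub>2\<close>, and a nonzero one of least degree is
  killed by \<open>\<partial>\<^sub>1 + \<partial>\<^sub>2\<close>. It is therefore of the form \<open>g(x\<^sub>1 - x\<^sub>2)\<close>
  (\<open>annihilating_difference_polynomial\<close>). Write \<open>g(z) = z\<^sup>k h(z)\<close> with \<open>h(0) \<noteq> 0\<close>. The two
  products \<open>(x\<^sub>1 - x\<^sub>2)\<^sup>k Y(u, x\<^sub>1) Y(v, x\<^sub>2) w\<close> and \<open>(x\<^sub>1 - x\<^sub>2)\<^sup>k Y(v, x\<^sub>2) Y(u, x\<^sub>1) w\<close>
  become equal after multiplication by \<open>h(x\<^sub>1 - x\<^sub>2)\<close>; a lowest term argument first shows that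
  both are lower truncated in both variables and then that they are equal
  (\<open>mult_diff_factor_cancel\<close>). This is locality in the usual sense (\<open>locality\<close>).

  Locality applied to the vacuum gives skew symmetry \<open>Y(u, x) v = exp (x D) Y(v, - x) u\<close>
  (\<open>skew_symmetry\<close>). Skew symmetry for \<open>Y(v, x\<^sub>2) w\<close> and for \<open>Y(Y(u, x\<^sub>0) v, x\<^sub>2) w\<close>, combined with
  locality of \<open>u\<close> and \<open>w\<close>, gives weak associativity
  \<open>(x\<^sub>0 + x\<^sub>2)\<^sup>l Y(u, x\<^sub>0 + x\<^sub>2) Y(v, x\<^sub>2) w = (x\<^sub>0 + x\<^sub>2)\<^sup>l Y(Y(u, x\<^sub>0) v, x\<^sub>2) w\<close>.

  Let \<open>J\<close> be the difference of the two sides of the Jacobi identity, applied to \<open>w\<close>. In terms of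
  its coefficients \<open>J(a, b, c)\<close> of \<open>x\<^sub>0\<^sup>a x\<^sub>1\<^sup>b x\<^sub>2\<^sup>c\<close>, locality says that \<open>J(a, b, c) = 0\<close> for all
  sufficiently negative \<open>a\<close>, and weak associativity that \<open>J(a, b, c) = 0\<close> for all sufficiently
  negative \<open>b\<close>, uniformly in the other exponents. Since
  \<open>(x\<^sub>0 - x\<^sub>1 + x\<^sub>2) J = 0\<close>, that is \<open>J(a - 1, b, c) = J(a, b - 1, c) - J(a, b, c - 1)\<close>,
  induction on \<open>b\<close> and \<open>a\<close> gives \<open>J = 0\<close>.
\<close>

section \<open>Cancelling factors in iterated Laurent series\<close>

text \<open>
  Multiplication by \<open>x\<^sub>1 - x\<^sub>2\<close> on formal distributions in two variables; \<open>A m n\<close> is the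
  coefficient of \<open>x\<^sub>1\<^sup>m x\<^sub>2\<^sup>n\<close>. The function is curried, so that \<open>mult_diff ^^ s\<close> is
  multiplication by \<open>(x\<^sub>1 - x\<^sub>2)\<^sup>s\<close>.
\<close>

definition mult_diff :: "(int \<Rightarrow> int \<Rightarrow> 'v) \<Rightarrow> int \<Rightarrow> int \<Rightarrow> 'v::ab_group_add" where
  "mult_diff A m n = A (m - 1) n - A m (n - 1)"

text \<open>
  Membership in \<open>V((x\<^sub>1))((x\<^sub>2))\<close>: only finitely many negative powers of \<open>x\<^sub>2\<close>, and the
  coefficient of each power of \<open>x\<^sub>2\<close> is a lower truncated series in \<open>x\<^sub>1\<close>.
\<close>

definition iterated_series :: "(int \<Rightarrow> int \<Rightarrow> 'v::zero) \<Rightarrow> bool" where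
  "iterated_series A \<longleftrightarrow>
     (\<exists>N. \<forall>m n. n < N \<longrightarrow> A m n = 0) \<and> (\<forall>n. \<exists>M. \<forall>m<M. A m n = 0)"

lemma iterated_series_bound:
  assumes "iterated_series A"
  obtains N where "\<And>m n. n < N \<Longrightarrow> A m n = 0"
  using assms unfolding iterated_series_def by blast

lemma iterated_series_row:
  assumes "iterated_series A"
  obtains M where "\<And>m. m < M \<Longrightarrow> A m n = 0"
  using assms unfolding iterated_series_def by blast

lemma mult_diff_funpow_diff:
  "(mult_diff ^^ s) (\<lambda>m n. A m n - B m n) m n = (mult_diff ^^ s) A m n - (mult_diff ^^ s) B m n"
  by (induction s arbitrary: m n) (simp_all add: mult_diff_def)

lemma mult_diff_funpow_eq_0:
  assumes "\<And>i j. i + j = s \<Longrightarrow> A (m - int i) (n - int j) = 0"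
  shows "(mult_diff ^^ s) A m n = 0"
  using assms
proof (induction s arbitrary: m n)
  case (Suc s)
  have "(mult_diff ^^ s) A (m - 1) n = 0"
    using Suc.prems[of "Suc i" j for i j] by (intro Suc.IH) (simp add: algebra_simps)
  moreover have "(mult_diff ^^ s) A m (n - 1) = 0"
    using Suc.prems[of i "Suc j" for i j] by (intro Suc.IH) (simp add: algebra_simps)
  ultimately show ?case by (simp add: mult_diff_def[of "(mult_diff ^^ s) A"])
qed simp

lemma iterated_series_mult_diff_funpow:
  assumes "iterated_series A"
  shows "iterated_series ((mult_diff ^^ s) A)"
proof (induction s)
  case (Suc s)
  let ?B = "(mult_diff ^^ s) A"
  obtain N where N: "\<And>m n. n < N \<Longrightarrow> ?B m n = 0"
    using Suc by (rule iterated_series_bound) (rule that)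
  have "\<exists>M. \<forall>m<M. mult_diff ?B m n = 0" for n
  proof -
    obtain M where M: "\<And>m. m < M \<Longrightarrow> ?B m n = 0"
      using Suc by (rule iterated_series_row) (rule that)
    obtain M' where M': "\<And>m. m < M' \<Longrightarrow> ?B m (n - 1) = 0"
      using Suc by (rule iterated_series_row) (rule that)
    show ?thesis
      by (rule exI[of _ "min M M'"]) (simp add: mult_diff_def M M')
  qed
  moreover have "\<forall>m n. n < N \<longrightarrow> mult_diff ?B m n = 0"
    by (simp add: mult_diff_def N)
  ultimately show ?case unfolding iterated_series_def by auto
qed (simp add: assms)

lemma mult_diff_funpow_swap:
  fixes A :: "int \<Rightarrow> int \<Rightarrow> 'v::ab_group_add"
  shows "(mult_diff ^^ s) (\<lambda>m n. A n m) m n =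
    (if even s then (mult_diff ^^ s) A n m else - (mult_diff ^^ s) A n m)"
  by (induction s arbitrary: m n) (auto simp: mult_diff_def)

context vector_space
begin

lemma mult_diff_funpow:
  "(mult_diff ^^ s) A m n =
     (\<Sum>j\<le>s. scale ((- 1) ^ j * of_nat (s choose j)) (A (m - int s + int j) (n - int j)))"
proof (induction s arbitrary: m n)
  case (Suc s)
  let ?f = "\<lambda>k j. scale ((- 1) ^ j * of_nat k) (A (m - int (Suc s) + int j) (n - int j))"
  have "(mult_diff ^^ Suc s) A m n =
      (\<Sum>j\<le>s. ?f (s choose j) j) + (\<Sum>j\<le>s. ?f (s choose j) (Suc j))"
    by (simp add: mult_diff_def Suc.IH algebra_simps sum_negf)
  also have "(\<Sum>j\<le>s. ?f (s choose j) j) = (\<Sum>j\<le>Suc s. ?f (s choose j) j)"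
    by (simp add: binomial_eq_0)
  also have "\<dots> = ?f (s choose 0) 0 + (\<Sum>j\<le>s. ?f (s choose Suc j) (Suc j))"
    by (rule sum.atMost_Suc_shift)
  also have "\<dots> + (\<Sum>j\<le>s. ?f (s choose j) (Suc j)) =
      ?f (Suc s choose 0) 0 + (\<Sum>j\<le>s. ?f (Suc s choose Suc j) (Suc j))"
    by (simp add: sum.distrib[symmetric] scale_left_distrib[symmetric] algebra_simps)
  also have "\<dots> = (\<Sum>j\<le>Suc s. ?f (Suc s choose j) j)"
    by (rule sum.atMost_Suc_shift[symmetric])
  finally show ?case .
qed simp

text \<open>
  Let \<open>h\<close> be a polynomial with \<open>h(0) \<noteq> 0\<close>. In a half plane \<open>m < M\<close>, which is closed under
  passing to smaller exponents, the lowest nonzero coefficient of \<open>A\<close> (least \<open>n\<close> first, then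
  least \<open>m\<close>) appears in \<open>h(x\<^sub>1 - x\<^sub>2) A\<close> multiplied by \<open>h(0)\<close>, so it cannot exist if
  that product vanishes there.
\<close>

lemma iterated_series_lowest_term:
  assumes A: "iterated_series A" and h: "h 0 \<noteq> 0"
    and eq: "\<And>m n. m < M \<Longrightarrow> (\<Sum>s\<le>d. scale (h s) ((mult_diff ^^ s) A m n)) = 0"
    and m: "m < M"
  shows "A m n = 0"
proof -
  obtain N where N: "\<And>m n. n < N \<Longrightarrow> A m n = 0"
    using A by (rule iterated_series_bound) (rule that)
  have "\<forall>m<M. A m n = 0" for n
  proof (induction "nat (n - N)" arbitrary: n rule: less_induct)
    case less
    have row: "A m n' = 0" if "n' < n" "m < M" for m n'
    proof (cases "n' < N")
      case False
      then show ?thesis using less[of n'] that by simp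
    qed (simp add: N)
    obtain K where K: "\<And>m. m < K \<Longrightarrow> A m n = 0"
      using A by (rule iterated_series_row) (rule that)
    have "A m n = 0" if "m < M" for m
      using that
    proof (induction "nat (m - K)" arbitrary: m rule: less_induct)
      case (less m)
      have col: "A m' n = 0" if "m' < m" for m'
      proof (cases "m' < K")
        case False
        then show ?thesis using less.hyps[of m'] less.prems that by simp
      qed (simp add: K)
      have "(mult_diff ^^ s) A m n = 0" if "s \<noteq> 0" for s
      proof (rule mult_diff_funpow_eq_0)
        fix i j assume "i + j = s"
        then show "A (m - int i) (n - int j) = 0"
          using that less.prems by (cases "j = 0") (auto intro: row col)
      qed
      then have "(\<Sum>s\<le>d. scale (h s) ((mult_diff ^^ s) A m n)) =
          (\<Sum>s\<in>{0}. scale (h s) ((mult_diff ^^ s) A m n))"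
        by (intro sum.mono_neutral_right) auto
      then show ?case using eq[of m n] less.prems h by simp
    qed
    then show ?case by blast
  qed
  then show ?thesis using m by blast
qed

text \<open>
  \<open>P\<close> lies in \<open>V((x\<^sub>1))((x\<^sub>2))\<close> and \<open>Q\<close> in \<open>V((x\<^sub>2))((x\<^sub>1))\<close>. There is no common module in
  which \<open>h(x\<^sub>1 - x\<^sub>2)\<close> could be cancelled at once: \<open>P - Q\<close> is a general distribution. But the
  common product is truncated in both variables, and the lowest term argument carries this
  over to \<open>P\<close> and \<open>Q\<close>, hence to \<open>P - Q\<close>.
\<close>

lemma mult_diff_factor_cancel:
  assumes P: "iterated_series P" and Q: "iterated_series (\<lambda>m n. Q n m)" and h: "h 0 \<noteq> 0"
    and eq: "\<And>m n. (\<Sum>s\<le>d. scale (h s) ((mult_diff ^^ s) P m n)) =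
                   (\<Sum>s\<le>d. scale (h s) ((mult_diff ^^ s) Q m n))"
  shows "P m n = Q m n"
proof -
  obtain N where N: "\<And>m n. n < N \<Longrightarrow> P m n = 0"
    using P by (rule iterated_series_bound) (rule that)
  obtain M where M: "\<And>m n. m < M \<Longrightarrow> Q m n = 0"
    using Q by (rule iterated_series_bound) (rule that)
  have P0: "P m n = 0" if "m < M" for m n
    using P h _ that
  proof (rule iterated_series_lowest_term[where d = d])
    fix m n assume "m < M"
    then have "(mult_diff ^^ s) Q m n = 0" for s
      by (intro mult_diff_funpow_eq_0 M) auto
    then show "(\<Sum>s\<le>d. scale (h s) ((mult_diff ^^ s) P m n)) = 0"
      by (simp add: eq)
  qed
  let ?h = "\<lambda>s. (- 1) ^ s * h s"
  have swap: "scale (?h s) ((mult_diff ^^ s) (\<lambda>m n. A n m) m n) =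
      scale (h s) ((mult_diff ^^ s) A n m)" for s m n A
    by (auto simp: mult_diff_funpow_swap[of s A])
  have Q0: "Q m n = 0" if "n < N" for m n
    using Q _ _ that
  proof (rule iterated_series_lowest_term[where d = d and h = ?h])
    fix m n assume "m < N"
    then have "(mult_diff ^^ s) P n m = 0" for s
      by (intro mult_diff_funpow_eq_0 N) auto
    then show "(\<Sum>s\<le>d. scale (?h s) ((mult_diff ^^ s) (\<lambda>m n. Q n m) m n)) = 0"
      unfolding swap eq[symmetric] by simp
  qed (simp add: h)
  let ?E = "\<lambda>m n. P m n - Q m n"
  have "?E m n = 0"
  proof (rule iterated_series_lowest_term[where d = d and h = h and M = "m + 1"])
    show "iterated_series ?E"
      unfolding iterated_series_def
      by (intro conjI exI[of _ N] exI[of _ M] allI impI) (simp_all add: N M P0 Q0)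
    show "(\<Sum>s\<le>d. scale (h s) ((mult_diff ^^ s) ?E m n)) = 0" for m n
      by (simp add: mult_diff_funpow_diff scale_right_diff_distrib sum_subtractf eq)
  qed (use h in auto)
  then show ?thesis by simp
qed

text \<open>
  If \<open>g(x\<^sub>1 - x\<^sub>2)\<close> annihilates \<open>P - Q\<close>, then so does the largest power of \<open>x\<^sub>1 - x\<^sub>2\<close>
  dividing it.
\<close>

lemma mult_diff_power_of_polynomial:
  assumes P: "iterated_series P" and Q: "iterated_series (\<lambda>m n. Q n m)"
    and g: "g k \<noteq> 0" "\<And>s. s < k \<Longrightarrow> g s = 0" "k \<le> d"
    and eq: "\<And>m n. (\<Sum>s\<le>d. scale (g s) ((mult_diff ^^ s) (\<lambda>m n. P m n - Q m n) m n)) = 0"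
  shows "(mult_diff ^^ k) P = (mult_diff ^^ k) Q"
proof -
  have split: "(\<Sum>s\<le>d. scale (g s) ((mult_diff ^^ s) A m n)) =
      (\<Sum>s\<le>d - k. scale (g (s + k)) ((mult_diff ^^ s) ((mult_diff ^^ k) A) m n))" for A m n
  proof -
    have "(\<Sum>s\<le>d. scale (g s) ((mult_diff ^^ s) A m n)) =
        (\<Sum>s\<in>{k..d}. scale (g s) ((mult_diff ^^ s) A m n))"
      by (rule sum.mono_neutral_right) (auto simp: g)
    also have "\<dots> = (\<Sum>s\<le>d - k. scale (g (s + k)) ((mult_diff ^^ (s + k)) A m n))"
      by (rule sum.reindex_bij_witness[of _ "\<lambda>s. s + k" "\<lambda>s. s - k"]) (use g in auto)
    finally show ?thesis by (simp add: funpow_add)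
  qed
  have "(mult_diff ^^ k) P m n = (mult_diff ^^ k) Q m n" for m n
  proof (rule mult_diff_factor_cancel[where h = "\<lambda>s. g (s + k)" and d = "d - k"])
    have "iterated_series ((mult_diff ^^ k) (\<lambda>m n. Q n m))"
      using Q by (rule iterated_series_mult_diff_funpow)
    then show "iterated_series (\<lambda>m n. (mult_diff ^^ k) Q n m)"
      by (cases "even k") (simp_all add: mult_diff_funpow_swap[of k Q] iterated_series_def)
    show "(\<Sum>s\<le>d - k. scale (g (s + k)) ((mult_diff ^^ s) ((mult_diff ^^ k) P) m n)) =
          (\<Sum>s\<le>d - k. scale (g (s + k)) ((mult_diff ^^ s) ((mult_diff ^^ k) Q) m n))" for m n
      using eq[of m n] unfolding split[symmetric]
      by (simp add: mult_diff_funpow_diff scale_right_diff_distrib sum_subtractf)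
  qed (use g P in \<open>auto intro: iterated_series_mult_diff_funpow\<close>)
  then show ?thesis by blast
qed

end

section \<open>From polynomial commutativity to locality\<close>

text \<open>
  A vertex operator map with vacuum vector and translation operator \<open>D\<close>, whose vertex operators
  commute pairwise up to multiplication by a nonzero polynomial that may depend on the pair.
\<close>

locale polynomially_commuting_map = vertex_operator_map scale Y
  for scale :: "complex \<Rightarrow> 'v::ab_group_add \<Rightarrow> 'v"
    and Y :: "'v \<Rightarrow> 'v \<Rightarrow> 'v fls" +
  fixes vac :: 'v
    and D :: "'v \<Rightarrow> 'v"
  assumes D_linear: "Vector_Spaces.linear scale scale D"
    and D_vac: "D vac = 0"
    and Y_vac: "\<And>w. Y vac w = fls_const w"
    and Y_creation: "\<And>v. Y v vac \<in> range fps_to_fls"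
    and Y_creation_limit: "\<And>v. Y v vac $$ 0 = v"
    and D_bracket: "\<And>v w. fls_map D (Y v w) - Y v (D w) = fls_ddx scale (Y v w)"
    and polynomial_commutativity: "\<And>u v. \<exists>f :: complex poly poly. f \<noteq> 0 \<and>
           (\<forall>w. series_mult scale (poly2_series f) (prod_12 Y u v w)
              = series_mult scale (poly2_series f) (prod_21 Y u v w))"
begin

sublocale D: Vector_Spaces.linear scale scale D
  by (rule D_linear)

text \<open>
  The series \<open>Y(u, x\<^sub>1) Y(v, x\<^sub>2) w\<close> and \<open>Y(v, x\<^sub>2) Y(u, x\<^sub>1) w\<close> in curried form.
\<close>

abbreviation (input) Y12 where "Y12 u v w \<equiv> (\<lambda>m n. prod_12 Y u v w (m, n))"
abbreviation (input) Y21 where "Y21 u v w \<equiv> (\<lambda>m n. prod_21 Y u v w (m, n))"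

lemma Y_linear_simps:
  "Y u (x + y) $$ n = Y u x $$ n + Y u y $$ n"
  "Y u (scale c x) $$ n = scale c (Y u x $$ n)"
proof -
  interpret Yu: Vector_Spaces.linear scale "fls_scale scale" "Y u" by (rule Y_hom)
  show "Y u (x + y) $$ n = Y u x $$ n + Y u y $$ n" by (simp add: Yu.add)
  show "Y u (scale c x) $$ n = scale c (Y u x $$ n)"
    by (simp add: Yu.scale vector_space_axioms)
qed

lemma Y_sum: "Y u (sum f S) $$ n = (\<Sum>i\<in>S. Y u (f i) $$ n)"
  by (induction S rule: infinite_finite_induct) (simp_all add: Y_linear_simps)

lemma D_Y: "D (Y u x $$ n) = Y u (D x) $$ n + scale (of_int (n + 1)) (Y u x $$ (n + 1))"
proof -
  have "(fls_map D (Y u x) - Y u (D x)) $$ n = fls_ddx scale (Y u x) $$ n"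
    by (simp add: D_bracket)
  then show ?thesis
    by (simp add: vector_space_axioms algebra_simps)
qed

lemma D_prod_12:
  "D (prod_12 Y u v w (m, n)) = prod_12 Y u v (D w) (m, n)
     + scale (of_int (m + 1)) (prod_12 Y u v w (m + 1, n))
     + scale (of_int (n + 1)) (prod_12 Y u v w (m, n + 1))"
  by (simp add: prod_12_def D_Y Y_linear_simps)

lemma D_prod_21:
  "D (prod_21 Y u v w (m, n)) = prod_21 Y u v (D w) (m, n)
     + scale (of_int (m + 1)) (prod_21 Y u v w (m + 1, n))
     + scale (of_int (n + 1)) (prod_21 Y u v w (m, n + 1))"
  by (simp add: prod_21_def D_Y Y_linear_simps)

lemma iterated_series_Y12: "iterated_series (Y12 u v w)"
proof -
  obtain N where "\<forall>n<N. Y v w $$ n = 0" by (rule fls_nth_vanishes_belowE)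
  moreover have "\<exists>M. \<forall>m<M. Y u (Y v w $$ n) $$ m = 0" for n
    by (metis fls_nth_vanishes_belowE)
  ultimately show ?thesis
    by (auto simp: iterated_series_def prod_12_def intro!: exI[of _ N])
qed

lemma iterated_series_Y21: "iterated_series (\<lambda>m n. prod_21 Y u v w (n, m))"
  using iterated_series_Y12[of v u w] by (simp add: prod_12_def prod_21_def)

text \<open>
  The commutator series \<open>[Y(u, x\<^sub>1), Y(v, x\<^sub>2)] w\<close>.
\<close>

definition commutator :: "'v \<Rightarrow> 'v \<Rightarrow> 'v \<Rightarrow> int \<Rightarrow> int \<Rightarrow> 'v" where
  "commutator u v w m n = prod_12 Y u v w (m, n) - prod_21 Y u v w (m, n)"

lemma D_commutator:
  "D (commutator u v w m n) = commutator u v (D w) m n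
     + scale (of_int (m + 1)) (commutator u v w (m + 1) n)
     + scale (of_int (n + 1)) (commutator u v w m (n + 1))"
  by (simp add: commutator_def D.diff D_prod_12 D_prod_21 algebra_simps)

text \<open>
  The polynomial with coefficients \<open>f i j\<close> of \<open>x\<^sub>1\<^sup>i x\<^sub>2\<^sup>j\<close>, for \<open>i, j \<le> K\<close>, annihilates
  the commutator of \<open>Y(u, x\<^sub>1)\<close> and \<open>Y(v, x\<^sub>2)\<close> on every vector. Polynomials are taken as
  coefficient functions, with a bound \<open>K\<close> on the summation that stays fixed while the degree
  decreases below.
\<close>

definition annihilates :: "nat \<Rightarrow> (nat \<Rightarrow> nat \<Rightarrow> complex) \<Rightarrow> 'v \<Rightarrow> 'v \<Rightarrow> bool" where
  "annihilates K f u v \<longleftrightarrow> (\<forall>w m n.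
     (\<Sum>i\<le>K. \<Sum>j\<le>K. scale (f i j) (commutator u v w (m - int i) (n - int j))) = 0)"

text \<open>
  The annihilator is stable under \<open>\<partial>\<^sub>1 + \<partial>\<^sub>2\<close>: bracketing with \<open>D\<close> acts on the commutator as
  \<open>\<partial>\<^sub>1 + \<partial>\<^sub>2\<close>, so that differentiating \<open>f C = 0\<close> gives \<open>((\<partial>\<^sub>1 + \<partial>\<^sub>2) f) C = 0\<close>.
\<close>

lemma annihilates_translation_derivative:
  assumes f: "annihilates K f u v" and supp: "\<And>i j. K < i + j \<Longrightarrow> f i j = 0"
  shows "annihilates K (\<lambda>i j. of_nat (Suc i) * f (Suc i) j + of_nat (Suc j) * f i (Suc j)) u v"
  unfolding annihilates_def
proof (intro allI)
  fix w m n
  let ?S = "\<lambda>g. \<Sum>i\<le>K. \<Sum>j\<le>K. g i j"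
  let ?C = "commutator u v w"
  have zero: "?S (\<lambda>i j. scale (f i j) (commutator u v w (m - int i) (n - int j))) = 0" for w m n
    using f by (simp add: annihilates_def)
  have shift: "(\<Sum>i\<le>K. g i) = (\<Sum>i\<le>K. g (Suc i))" if "g 0 = 0" "g (Suc K) = 0" for g :: "nat \<Rightarrow> 'v"
    using sum.atMost_Suc_shift[of g K] sum.atMost_Suc[of g K] that by simp
  have "?S (\<lambda>i j. scale (of_nat (Suc i) * f (Suc i) j) (?C (m - int i) (n - int j))) =
        ?S (\<lambda>i j. scale (of_nat i * f i j) (?C (m + 1 - int i) (n - int j)))"
    using shift[of "\<lambda>i. \<Sum>j\<le>K. scale (of_nat i * f i j) (?C (m + 1 - int i) (n - int j))"]
    by (simp add: supp add.commute[of 1])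
  moreover have "?S (\<lambda>i j. scale (of_nat (Suc j) * f i (Suc j)) (?C (m - int i) (n - int j))) =
        ?S (\<lambda>i j. scale (of_nat j * f i j) (?C (m - int i) (n + 1 - int j)))"
  proof (rule sum.cong[OF refl])
    fix i
    show "(\<Sum>j\<le>K. scale (of_nat (Suc j) * f i (Suc j)) (?C (m - int i) (n - int j))) =
        (\<Sum>j\<le>K. scale (of_nat j * f i j) (?C (m - int i) (n + 1 - int j)))"
      using shift[of "\<lambda>j. scale (of_nat j * f i j) (?C (m - int i) (n + 1 - int j))"]
      by (simp add: supp add.commute[of 1])
  qed
  moreover have "?S (\<lambda>i j. scale (of_nat i * f i j) (?C (m + 1 - int i) (n - int j)))
      + ?S (\<lambda>i j. scale (of_nat j * f i j) (?C (m - int i) (n + 1 - int j)))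
    = scale (of_int (m + 1)) (?S (\<lambda>i j. scale (f i j) (?C (m + 1 - int i) (n - int j))))
      + scale (of_int (n + 1)) (?S (\<lambda>i j. scale (f i j) (?C (m - int i) (n + 1 - int j))))
      + ?S (\<lambda>i j. scale (f i j) (commutator u v (D w) (m - int i) (n - int j)))
      - D (?S (\<lambda>i j. scale (f i j) (?C (m - int i) (n - int j))))"
    unfolding D.sum D.scale D_commutator scale_sum_right sum.distrib[symmetric] sum_subtractf[symmetric]
    by (intro sum.cong refl)
       (simp add: scale_left_distrib scale_right_distrib scale_left_diff_distrib
          scale_right_diff_distrib algebra_simps)
  ultimately show "?S (\<lambda>i j. scale (of_nat (Suc i) * f (Suc i) j + of_nat (Suc j) * f i (Suc j))
      (?C (m - int i) (n - int j))) = 0"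
    by (simp add: scale_left_distrib sum.distrib zero D.zero)
qed

text \<open>
  A polynomial killed by \<open>\<partial>\<^sub>1 + \<partial>\<^sub>2\<close> is a polynomial in \<open>x\<^sub>1 - x\<^sub>2\<close>.
\<close>

lemma translation_invariant_coeffs:
  fixes f :: "nat \<Rightarrow> nat \<Rightarrow> complex"
  assumes "\<And>i j. of_nat (Suc i) * f (Suc i) j + of_nat (Suc j) * f i (Suc j) = 0"
  shows "f i j = (- 1) ^ j * of_nat ((i + j) choose j) * f (i + j) 0"
proof (induction j arbitrary: i)
  case (Suc j)
  let ?c = "\<lambda>k. of_nat ((i + Suc j) choose k) :: complex"
  have "of_nat (Suc j) * f i (Suc j) = - (of_nat (Suc i) * f (Suc i) j)"
    using assms[of i j] by (simp add: eq_neg_iff_add_eq_0 add.commute)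
  also have "\<dots> = - ((- 1) ^ j) * (of_nat (Suc i) * ?c j) * f (i + Suc j) 0"
    by (simp add: Suc.IH)
  also have "of_nat (Suc i) * ?c j = of_nat (Suc j) * ?c (Suc j)"
    using binomial_absorb_comp[of "i + Suc j" j] Suc_times_binomial[of j "i + j"]
    by (simp del: of_nat_Suc of_nat_add of_nat_mult binomial_Suc_Suc add: of_nat_mult[symmetric])
  finally have "of_nat (Suc j) * f i (Suc j) =
      of_nat (Suc j) * ((- 1) ^ Suc j * ?c (Suc j) * f (i + Suc j) 0)"
    by simp
  then show ?case by (simp only: mult_cancel_left of_nat_eq_0_iff) simp
qed simp

lemma annihilating_polynomial:
  obtains K f where "annihilates K f u v" "\<And>i j. K < i + j \<Longrightarrow> f i j = 0" "\<exists>i j. f i j \<noteq> 0"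
proof -
  obtain p :: "complex poly poly" where p: "p \<noteq> 0"
    and eq: "\<And>w. series_mult scale (poly2_series p) (prod_12 Y u v w)
              = series_mult scale (poly2_series p) (prod_21 Y u v w)"
    using polynomial_commutativity by blast
  let ?f = "\<lambda>i j. coeff (coeff p j) i"
  define K where "K = degree p + (\<Sum>j\<le>degree p. degree (coeff p j))"
  have supp: "?f i j = 0" if "K < i + j" for i j
  proof (cases "j \<le> degree p")
    case True
    then have "degree (coeff p j) \<le> (\<Sum>j\<le>degree p. degree (coeff p j))"
      by (intro member_le_sum) auto
    then show ?thesis using that True by (intro coeff_eq_0) (simp add: K_def)
  qed (simp add: coeff_eq_0)
  have mult: "series_mult scale (poly2_series p) A (m, n) =
      (\<Sum>i\<le>K. \<Sum>j\<le>K. scale (?f i j) (A (m - int i, n - int j)))" for A m n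
  proof -
    let ?g = "\<lambda>(i, j). (int i, int j)"
    let ?F = "\<lambda>d. scale (poly2_series p d) (A ((m, n) - d))"
    have "series_mult scale (poly2_series p) A (m, n) = sum ?F (?g ` ({..K} \<times> {..K}))"
      unfolding series_mult_def
    proof (rule Sum_any.expand_superset)
      show "{d. ?F d \<noteq> 0} \<subseteq> ?g ` ({..K} \<times> {..K})"
      proof
        fix d assume d: "d \<in> {d. ?F d \<noteq> 0}"
        obtain i j where ij: "d = (i, j)" by (cases d)
        have nz: "0 \<le> i" "0 \<le> j" "?f (nat i) (nat j) \<noteq> 0"
          using d by (auto simp: ij poly2_series_def split: if_splits)
        then have "nat i + nat j \<le> K" using supp by (meson not_le)
        then show "d \<in> ?g ` ({..K} \<times> {..K})"
          using nz by (intro image_eqI[of _ _ "(nat i, nat j)"]) (auto simp: ij)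
      qed
    qed simp
    also have "\<dots> = (\<Sum>(i, j)\<in>{..K} \<times> {..K}. ?F (int i, int j))"
      by (subst sum.reindex) (auto simp: inj_on_def intro!: sum.cong)
    finally show ?thesis
      by (simp add: sum.cartesian_product poly2_series_def minus_prod_def)
  qed
  have "annihilates K ?f u v"
    unfolding annihilates_def commutator_def scale_right_diff_distrib sum_subtractf
    unfolding mult[symmetric] eq by simp
  moreover have "\<exists>i j. ?f i j \<noteq> 0"
    using p by (metis leading_coeff_0_iff)
  ultimately show ?thesis using supp that by blast
qed

lemma annihilating_difference_polynomial:
  obtains d g where "\<And>w m n. (\<Sum>s\<le>d. scale (g s) ((mult_diff ^^ s) (commutator u v w) m n)) = 0"
    and "\<exists>s\<le>d. g s \<noteq> 0"
proof -
  obtain K f0 where f0: "annihilates K f0 u v" "\<And>i j. K < i + j \<Longrightarrow> f0 i j = 0" "\<exists>i j. f0 i j \<noteq> 0"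
    by (rule annihilating_polynomial[of u v]) (rule that)
  \<comment> \<open>\<open>P d\<close>: some nonzero annihilating polynomial has total degree at most \<open>d\<close>.
    For the least such \<open>d\<close>, the derivative \<open>f'\<close> of a corresponding \<open>f\<close> vanishes.\<close>
  define P where "P d \<longleftrightarrow> (\<exists>f. annihilates K f u v \<and> (\<forall>i j. d < i + j \<longrightarrow> f i j = 0) \<and>
    (\<exists>i j. f i j \<noteq> 0))" for d
  define d where "d = (LEAST d. P d)"
  have "P K" using f0 unfolding P_def by blast
  then have "P d" and dK: "d \<le> K"
    unfolding d_def by (rule LeastI, rule Least_le)
  then obtain f where f: "annihilates K f u v" "\<And>i j. d < i + j \<Longrightarrow> f i j = 0" "\<exists>i j. f i j \<noteq> 0"
    unfolding P_def by blast
  define f' where "f' i j = of_nat (Suc i) * f (Suc i) j + of_nat (Suc j) * f i (Suc j)" for i j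
  have "f' i j = 0" for i j
  proof (rule ccontr)
    assume nz: "f' i j \<noteq> 0"
    have supp': "f' i j = 0" if "d \<le> i + j" for i j
      using that f(2) by (simp add: f'_def)
    have "annihilates K f' u v"
      unfolding f'_def using f dK by (intro annihilates_translation_derivative) auto
    moreover have "d \<noteq> 0" using nz supp' by (metis zero_le)
    moreover from this have "\<forall>i j. d - 1 < i + j \<longrightarrow> f' i j = 0"
      using supp' by simp
    ultimately have "P (d - 1)" and "d \<noteq> 0"
      using nz unfolding P_def by blast+
    then have "d \<le> d - 1" unfolding d_def by (metis Least_le)
    with \<open>d \<noteq> 0\<close> show False by simp
  qed
  then have coeffs: "f i j = (- 1) ^ j * of_nat ((i + j) choose j) * f (i + j) 0" for i j
    unfolding f'_def by (rule translation_invariant_coeffs)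
  have "(\<Sum>s\<le>K. scale (f s 0) ((mult_diff ^^ s) (commutator u v w) m n)) = 0" for w m n
  proof -
    have "0 = (\<Sum>i\<le>K. \<Sum>j\<le>K. scale (f i j) (commutator u v w (m - int i) (n - int j)))"
      using f(1) by (simp add: annihilates_def)
    also have "\<dots> = (\<Sum>(j, i)\<in>{..K} \<times> {..K}. scale (f i j) (commutator u v w (m - int i) (n - int j)))"
      by (subst sum.swap) (simp add: sum.cartesian_product)
    also have "\<dots> = (\<Sum>(j, i)\<in>{(j, i). j + i \<le> K}. scale (f i j) (commutator u v w (m - int i) (n - int j)))"
    proof (intro sum.mono_neutral_right)
      have "f i j = 0" if "\<not> j + i \<le> K" for i j
        using that dK by (intro f(2)) simp
      then show "\<forall>p\<in>{..K} \<times> {..K} - {(j, i). j + i \<le> K}.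
          (case p of (j, i) \<Rightarrow> scale (f i j) (commutator u v w (m - int i) (n - int j))) = 0"
        by fastforce
    qed auto
    also have "\<dots> = (\<Sum>s\<le>K. \<Sum>j\<le>s. scale (f (s - j) j)
        (commutator u v w (m - int (s - j)) (n - int j)))"
      by (rule sum.triangle_reindex_eq)
    also have "\<dots> = (\<Sum>s\<le>K. scale (f s 0) ((mult_diff ^^ s) (commutator u v w) m n))"
      unfolding mult_diff_funpow scale_sum_right
    proof (intro sum.cong refl)
      fix s j :: nat assume "j \<in> {..s}"
      then show "scale (f (s - j) j) (commutator u v w (m - int (s - j)) (n - int j)) =
          scale (f s 0) (scale ((- 1) ^ j * of_nat (s choose j)) (commutator u v w (m - int s + int j) (n - int j)))"
        by (subst coeffs) (simp add: of_nat_diff algebra_simps)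
    qed
    finally show ?thesis by simp
  qed
  moreover have "\<exists>s\<le>K. f s 0 \<noteq> 0"
  proof -
    obtain i j where "f i j \<noteq> 0" using f(3) by blast
    then have "f (i + j) 0 \<noteq> 0" using coeffs[of i j] by auto
    moreover from this have "i + j \<le> K" using f(2)[of "i + j" 0] dK by (metis add_0_right leI le_trans)
    ultimately show ?thesis by blast
  qed
  ultimately show ?thesis by (rule that)
qed

text \<open>
  The exponent \<open>k\<close> depends on \<open>u\<close> and \<open>v\<close> only, not on the vector \<open>w\<close>.
\<close>

lemma locality:
  obtains k where "\<And>w l. k \<le> l \<Longrightarrow> (mult_diff ^^ l) (Y12 u v w) = (mult_diff ^^ l) (Y21 u v w)"
proof -
  obtain d g where g: "\<And>w m n. (\<Sum>s\<le>d. scale (g s) ((mult_diff ^^ s) (commutator u v w) m n)) = 0"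
    and nz: "\<exists>s\<le>d. g s \<noteq> 0"
    by (rule annihilating_difference_polynomial[of u v]) (rule that)
  define k where "k = (LEAST s. g s \<noteq> 0)"
  have "g k \<noteq> 0"
    using nz unfolding k_def by (metis (mono_tags, lifting) LeastI)
  moreover have "k \<le> d"
    using nz unfolding k_def by (metis (mono_tags, lifting) Least_le order_trans)
  moreover have "\<And>s. s < k \<Longrightarrow> g s = 0"
    unfolding k_def by (blast dest: not_less_Least)
  ultimately have k: "g k \<noteq> 0" "k \<le> d" "\<And>s. s < k \<Longrightarrow> g s = 0"
    by blast+
  have "(mult_diff ^^ k) (Y12 u v w) = (mult_diff ^^ k) (Y21 u v w)" for w
    using g[of w] k unfolding commutator_def
    by (intro mult_diff_power_of_polynomial[of _ _ g k d] iterated_series_Y12 iterated_series_Y21) 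
  then have "(mult_diff ^^ (i + k)) (Y12 u v w) = (mult_diff ^^ (i + k)) (Y21 u v w)" for w i
    by (simp add: funpow_add)
  then show ?thesis by (intro that[of k]) (metis le_add_diff_inverse2)
qed

end

section \<open>Skew symmetry\<close>

text \<open>
  Binomial coefficients whose lower index is an integer, with value \<open>0\<close> if it is negative.
\<close>

definition binomial_int :: "int \<Rightarrow> int \<Rightarrow> complex" where
  "binomial_int n p = (if p < 0 then 0 else of_int n gchoose nat p)"

lemma binomial_int_of_nat [simp]: "binomial_int n (int p) = of_int n gchoose p"
  by (simp add: binomial_int_def)

lemma binomial_int_negative:
  "of_int (- 1 - int l + int q) gchoose q = ((- 1) ^ q * of_nat (l choose q) :: complex)"
  by (subst gbinomial_negated_upper) (simp add: binomial_gbinomial algebra_simps)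

lemma neg_one_powi_eq_power: "(- 1 :: complex) powi (n - int j) = (- 1) powi n * (- 1) ^ j"
  by (cases "even j") (simp_all add: power_int_diff)

text \<open>
  This is \<open>\<Sum>j. (k choose k - j) (q choose q + j) = (k + q choose k + q)\<close>; the exponent \<open>q\<close> may
  be negative.
\<close>

lemma Vandermonde_shifted:
  assumes "0 \<le> q + int k"
  shows "(\<Sum>j\<le>k. of_nat (k choose j) * binomial_int q (q + int j)) = 1"
proof -
  define t where "t = nat (q + int k)"
  have t: "int t = q + int k" using assms by (simp add: t_def)
  have "(\<Sum>j\<le>k. of_nat (k choose j) * binomial_int q (q + int j)) =
      (\<Sum>j\<in>{j. j \<le> k \<and> 0 \<le> q + int j}. of_nat (k choose j) * binomial_int q (q + int j))"
    by (rule sum.mono_neutral_right) (auto simp: binomial_int_def)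
  also have "\<dots> = (\<Sum>p\<in>{p. p \<le> t \<and> t - p \<le> k}. (of_nat k gchoose (t - p)) * (of_int q gchoose p))"
  proof (rule sum.reindex_bij_witness[of _ "\<lambda>p. nat (int p - q)" "\<lambda>j. nat (q + int j)"])
    fix j assume j: "j \<in> {j. j \<le> k \<and> 0 \<le> q + int j}"
    have "t - nat (q + int j) = k - j" using j t by auto
    then show "(of_nat k gchoose (t - nat (q + int j))) * (of_int q gchoose nat (q + int j)) =
        of_nat (k choose j) * binomial_int q (q + int j)"
      using j by (simp add: binomial_int_def binomial_gbinomial[symmetric] binomial_symmetric[symmetric])
  qed (use t in auto)
  also have "\<dots> = (\<Sum>p\<in>{0..t}. (of_nat k gchoose (t - p)) * (of_int q gchoose p))"
    by (rule sum.mono_neutral_left) (auto simp: binomial_gbinomial[symmetric] binomial_eq_0)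
  also have "\<dots> = (of_int q + of_nat k) gchoose t"
    using gbinomial_Vandermonde[of "of_int q :: complex" "of_nat k" t] by (simp add: mult.commute)
  also have "of_int q + of_nat k = (of_nat t :: complex)"
    using arg_cong[OF t, of "of_int :: int \<Rightarrow> complex"] by simp
  finally show ?thesis by (simp add: binomial_gbinomial[symmetric])
qed

context polynomially_commuting_map
begin

text \<open>
  The divided power \<open>D\<^sup>j / j!\<close>, so that \<open>exp (x D) = \<Sum>j. x\<^sup>j divided_D j\<close>.
\<close>

definition divided_D :: "nat \<Rightarrow> 'v \<Rightarrow> 'v" where
  "divided_D j x = scale (inverse (fact j)) ((D ^^ j) x)"

lemma D_funpow_add: "(D ^^ j) (x + y) = (D ^^ j) x + (D ^^ j) y"
  by (induction j) (simp_all add: D.add)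

lemma D_funpow_scale: "(D ^^ j) (scale c x) = scale c ((D ^^ j) x)"
  by (induction j) (simp_all add: D.scale)

lemma divided_D_add: "divided_D j (x + y) = divided_D j x + divided_D j y"
  by (simp add: divided_D_def D_funpow_add scale_right_distrib)

lemma divided_D_scale: "divided_D j (scale c x) = scale c (divided_D j x)"
  by (simp add: divided_D_def D_funpow_scale mult.commute)

lemma divided_D_zero [simp]: "divided_D j 0 = 0"
  using divided_D_scale[of j 0 0] by simp

lemma divided_D_sum: "divided_D j (sum f S) = (\<Sum>i\<in>S. divided_D j (f i))"
  by (induction S rule: infinite_finite_induct) (simp_all add: divided_D_add)

lemma divided_D_0 [simp]: "divided_D 0 x = x"
  by (simp add: divided_D_def)

lemma D_divided_D: "D (divided_D j x) = scale (of_nat (Suc j)) (divided_D (Suc j) x)"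
proof -
  have "of_nat (Suc j) * inverse (fact (Suc j)) = (inverse (fact j) :: complex)"
    by (simp add: field_simps del: of_nat_Suc)
  then show ?thesis by (simp add: divided_D_def D.scale del: of_nat_Suc fact_Suc)
qed

text \<open>
  Together with the next lemma: \<open>Y(u, x) vac = exp (x D) u\<close>.
\<close>

lemma Y_vac_eq_divided_D: "Y u vac $$ int j = divided_D j u"
proof (induction j)
  case (Suc j)
  have "scale (of_nat (Suc j)) (Y u vac $$ int (Suc j)) = D (Y u vac $$ int j)"
    by (simp add: D_Y D_vac add.commute)
  also have "\<dots> = scale (of_nat (Suc j)) (divided_D (Suc j) u)"
    by (simp only: Suc.IH D_divided_D)
  finally show ?case by (simp del: of_nat_Suc)
qed (simp add: Y_creation_limit)

lemma Y_vac_negative: "n < 0 \<Longrightarrow> Y u vac $$ n = 0"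
  using Y_creation[of u] by (auto simp: image_iff)

text \<open>
  The coefficients of the conjugation formula
  \<open>Y(u, y) exp (x D) = exp (x D) Y(u, y - x)\<close>.
\<close>

lemma Y_divided_D:
  "Y u (divided_D j x) $$ n =
     (\<Sum>p\<le>j. scale ((- 1) ^ p * (of_int (n + int p) gchoose p))
        (divided_D (j - p) (Y u x $$ (n + int p))))"
proof (induction j arbitrary: n)
  case (Suc j)
  let ?c = "\<lambda>p. (- 1) ^ p * (of_int (n + int p) gchoose p) :: complex"
  let ?y = "\<lambda>p. divided_D (Suc j - p) (Y u x $$ (n + int p))"
  have "scale (of_nat (Suc j)) (Y u (divided_D (Suc j) x) $$ n) = Y u (D (divided_D j x)) $$ n"
    by (simp only: D_divided_D Y_linear_simps)
  also have "\<dots> = D (Y u (divided_D j x) $$ n)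
      - scale (of_int (n + 1)) (Y u (divided_D j x) $$ (n + 1))"
    by (simp add: D_Y)
  also have "D (Y u (divided_D j x) $$ n) = (\<Sum>p\<le>j. scale (of_nat (Suc j - p) * ?c p) (?y p))"
    unfolding Suc.IH D.sum D.scale D_divided_D
    by (intro sum.cong refl) (simp add: Suc_diff_le mult.commute del: of_nat_Suc)
  also have "\<dots> = (\<Sum>p\<le>Suc j. scale (of_nat (Suc j - p) * ?c p) (?y p))"
    by simp
  also have "scale (of_int (n + 1)) (Y u (divided_D j x) $$ (n + 1)) =
      (\<Sum>p\<le>j. - scale (of_nat (Suc p) * ?c (Suc p)) (?y (Suc p)))"
    unfolding Suc.IH scale_sum_right
  proof (intro sum.cong refl)
    fix p
    have "of_nat (Suc p) * (of_int (n + int (Suc p)) gchoose Suc p) =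
        of_int (n + 1) * (of_int (n + int (Suc p)) gchoose p :: complex)"
      using gbinomial_absorption[of p "of_int (n + int (Suc p)) :: complex"]
        gbinomial_absorb_comp[of "of_int (n + int (Suc p)) :: complex" p]
      by (simp add: algebra_simps)
    moreover have "of_nat (Suc p) * ?c (Suc p) =
        - ((- 1) ^ p * (of_nat (Suc p) * (of_int (n + int (Suc p)) gchoose Suc p)))"
      by (simp only: power_Suc) (simp only: mult_minus_left mult_1_left mult_minus_right mult.left_commute)
    ultimately have "of_nat (Suc p) * ?c (Suc p) =
        - (of_int (n + 1) * ((- 1) ^ p * (of_int (n + 1 + int p) gchoose p)))"
      by (simp only: mult.left_commute of_nat_Suc add_ac int_Suc)
    then show "scale (of_int (n + 1)) (scale ((- 1) ^ p * (of_int (n + 1 + int p) gchoose p))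
          (divided_D (j - p) (Y u x $$ (n + 1 + int p)))) =
        - scale (of_nat (Suc p) * ?c (Suc p)) (?y (Suc p))"
      by (simp add: add.assoc)
  qed
  also have "\<dots> = (\<Sum>p\<le>Suc j. - scale (of_nat p * ?c p) (?y p))"
    unfolding sum.atMost_Suc_shift[of _ j] by simp
  also have "(\<Sum>p\<le>Suc j. scale (of_nat (Suc j - p) * ?c p) (?y p)) - \<dots> =
      (\<Sum>p\<le>Suc j. scale (of_nat (Suc j)) (scale (?c p) (?y p)))"
    unfolding sum_subtractf[symmetric]
  proof (intro sum.cong refl)
    fix p assume "p \<in> {..Suc j}"
    then have "of_nat (Suc j - p) * ?c p + of_nat p * ?c p = of_nat (Suc j) * ?c p"
      by (simp add: of_nat_diff algebra_simps)
    then show "scale (of_nat (Suc j - p) * ?c p) (?y p) - - scale (of_nat p * ?c p) (?y p) =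
        scale (of_nat (Suc j)) (scale (?c p) (?y p))"
      by (simp add: scale_left_distrib[symmetric] del: of_nat_Suc)
  qed
  finally show ?case
    unfolding scale_sum_right[symmetric] by (simp only: scale_cancel_left of_nat_eq_0_iff nat.distinct simp_thms)
qed simp

text \<open>
  The same sum indexed by the power of \<open>D\<close>, over a range that does not depend on \<open>j\<close>; the
  additional terms vanish by the convention for \<open>binomial_int\<close>.
\<close>

lemma Y_divided_D_padded:
  assumes "j \<le> M"
  shows "Y u (divided_D j x) $$ n =
     (\<Sum>r\<le>M. scale ((- 1) powi (int j - int r) * binomial_int (n + int j - int r) (int j - int r))
        (divided_D r (Y u x $$ (n + int j - int r))))"
proof -
  have "Y u (divided_D j x) $$ n =
     (\<Sum>r\<le>j. scale ((- 1) powi (int j - int r) * binomial_int (n + int j - int r) (int j - int r))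
        (divided_D r (Y u x $$ (n + int j - int r))))"
    unfolding Y_divided_D
  proof (rule sum.reindex_bij_witness[of _ "\<lambda>r. j - r" "\<lambda>p. j - p"])
    fix p assume "p \<in> {..j}"
    then have "int p = int j - int (j - p)" by (simp add: of_nat_diff)
    then show "scale ((- 1) powi (int j - int (j - p)) *
          binomial_int (n + int j - int (j - p)) (int j - int (j - p)))
        (divided_D (j - p) (Y u x $$ (n + int j - int (j - p)))) =
      scale ((- 1) ^ p * (of_int (n + int p) gchoose p)) (divided_D (j - p) (Y u x $$ (n + int p)))"
      by (metis add_diff_eq binomial_int_of_nat power_int_of_nat)
  qed auto
  also have "\<dots> = (\<Sum>r\<le>M. scale ((- 1) powi (int j - int r) * binomial_int (n + int j - int r) (int j - int r))
        (divided_D r (Y u x $$ (n + int j - int r))))"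
    using assms by (intro sum.mono_neutral_left) (auto simp: binomial_int_def)
  finally show ?thesis .
qed

text \<open>
  \<open>Y(u, x) v = exp (x D) Y(v, - x) u\<close>. This is the coefficient of \<open>x\<^sub>1\<^sup>c\<^sup>+\<^sup>k x\<^sub>2\<^sup>0\<close> in
  \<open>(x\<^sub>1 - x\<^sub>2)\<^sup>k Y(u, x\<^sub>1) Y(v, x\<^sub>2) vac = (x\<^sub>1 - x\<^sub>2)\<^sup>k Y(v, x\<^sub>2) Y(u, x\<^sub>1) vac\<close>. On the left only
  the constant term of \<open>Y(v, x\<^sub>2) vac\<close> contributes; on the right \<open>Y(u, x\<^sub>1) vac = exp (x\<^sub>1 D) u\<close>
  is moved to the left by conjugation.
\<close>

lemma skew_symmetry:
  assumes M: "\<And>n. n < c - int M \<Longrightarrow> Y v u $$ n = 0"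
  shows "Y u v $$ c = (\<Sum>r\<le>M. scale ((- 1) powi (c - int r)) (divided_D r (Y v u $$ (c - int r))))"
proof -
  obtain k0 where k0: "\<And>w l. k0 \<le> l \<Longrightarrow> (mult_diff ^^ l) (Y12 u v w) = (mult_diff ^^ l) (Y21 u v w)"
    by (rule locality[of u v]) (rule that)
  \<comment> \<open>The sum obtained below runs over \<open>r \<le> c + k\<close>, and has to contain all \<open>r \<le> M\<close>.\<close>
  define k where "k = max k0 (nat (int M - c))"
  have k: "k0 \<le> k" "int M \<le> c + int k" by (auto simp: k_def)
  define K where "K = nat (c + int k)"
  have K: "int K = c + int k" "M \<le> K" using k by (auto simp: K_def)
  let ?y = "\<lambda>r. divided_D r (Y v u $$ (c - int r))"
  let ?b = "\<lambda>j. (- 1) ^ j * of_nat (k choose j) :: complex"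
  have "Y u v $$ c = (mult_diff ^^ k) (Y12 u v vac) (c + int k) 0"
  proof -
    have "(mult_diff ^^ k) (Y12 u v vac) (c + int k) 0 =
        (\<Sum>j\<in>{0}. scale (?b j) (Y12 u v vac (c + int k - int k + int j) (0 - int j)))"
      unfolding mult_diff_funpow
      by (rule sum.mono_neutral_right) (auto simp: prod_12_def Y_vac_negative)
    then show ?thesis by (simp add: prod_12_def Y_creation_limit)
  qed
  also have "\<dots> = (mult_diff ^^ k) (Y21 u v vac) (c + int k) 0"
    using k0[OF k(1)] by simp
  also have "\<dots> = (\<Sum>j\<le>k. scale (?b j) (Y v (Y u vac $$ (c + int j)) $$ (- int j)))"
    by (simp add: mult_diff_funpow prod_21_def)
  also have "\<dots> = (\<Sum>j\<le>k. \<Sum>r\<le>K. scale ((- 1) powi (c - int r) *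
      (of_nat (k choose j) * binomial_int (c - int r) (c - int r + int j))) (?y r))"
  proof (intro sum.cong[OF refl])
    fix j assume j: "j \<in> {..k}"
    show "scale (?b j) (Y v (Y u vac $$ (c + int j)) $$ (- int j)) =
        (\<Sum>r\<le>K. scale ((- 1) powi (c - int r) *
      (of_nat (k choose j) * binomial_int (c - int r) (c - int r + int j))) (?y r))"
    proof (cases "c + int j < 0")
      case True
      then show ?thesis by (simp add: Y_vac_negative binomial_int_def)
    next
      case False
      define m where "m = nat (c + int j)"
      have m: "c + int j = int m" "int m - int j = c" "m \<le> K" using False j K by (auto simp: m_def)
      have "scale (?b j) (Y v (Y u vac $$ (c + int j)) $$ (- int j)) =
          (\<Sum>r\<le>K. scale (?b j) (scale ((- 1) powi (int m - int r) * binomial_int (- int j + int m - int r) (int m - int r))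
            (divided_D r (Y v u $$ (- int j + int m - int r)))))"
        unfolding m(1) Y_vac_eq_divided_D Y_divided_D_padded[OF m(3)] scale_sum_right ..
      also have "\<dots> = (\<Sum>r\<le>K. scale ((- 1) powi (c - int r) *
          (of_nat (k choose j) * binomial_int (c - int r) (c - int r + int j))) (?y r))"
      proof (intro sum.cong[OF refl])
        fix r
        have eqs: "int m - int r = c - int r + int j" "- int j + int m - int r = c - int r"
          using m by auto
        show "scale (?b j) (scale ((- 1) powi (int m - int r) * binomial_int (- int j + int m - int r) (int m - int r))
            (divided_D r (Y v u $$ (- int j + int m - int r)))) =
          scale ((- 1) powi (c - int r) *
          (of_nat (k choose j) * binomial_int (c - int r) (c - int r + int j))) (?y r)"
          unfolding eqs by (simp add: power_int_add mult_ac flip: power_mult_distrib)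
      qed
      finally show ?thesis .
    qed
  qed
  also have "\<dots> = (\<Sum>r\<le>K. scale ((- 1) powi (c - int r) *
      (\<Sum>j\<le>k. of_nat (k choose j) * binomial_int (c - int r) (c - int r + int j))) (?y r))"
    by (subst sum.swap) (simp only: sum_distrib_left scale_sum_left)
  also have "\<dots> = (\<Sum>r\<le>K. scale ((- 1) powi (c - int r)) (?y r))"
    using K by (intro sum.cong refl, subst Vandermonde_shifted) auto
  also have "\<dots> = (\<Sum>r\<le>M. scale ((- 1) powi (c - int r)) (?y r))"
    using K M by (intro sum.mono_neutral_right) auto
  finally show ?thesis .
qed

end

section \<open>Coefficients of the products with delta series\<close>

lemma (in vertex_operator_map) series_mult_delta_12_0:
  assumes M: "\<And>n. n < c - int M \<Longrightarrow> Y v w $$ n = 0"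
  shows "series_mult scale delta_12_0 (in_12 (prod_12 Y u v w)) (a, b, c) =
    (\<Sum>k\<le>M. scale ((- 1) ^ k * (of_int (- a - 1) gchoose k))
      (prod_12 Y u v w (b + a + 1 + int k, c - int k)))"
proof -
  let ?F = "\<lambda>d. scale (delta_12_0 d) (in_12 (prod_12 Y u v w) ((a, b, c) - d))"
  let ?g = "\<lambda>k. (a, - a - 1 - int k, int k)"
  have "series_mult scale delta_12_0 (in_12 (prod_12 Y u v w)) (a, b, c) = sum ?F (?g ` {..M})"
    unfolding series_mult_def
  proof (rule Sum_any.expand_superset)
    show "{d. ?F d \<noteq> 0} \<subseteq> ?g ` {..M}"
    proof
      fix d assume d: "d \<in> {d. ?F d \<noteq> 0}"
      obtain i j k where ijk: "d = (i, j, k)" by (cases d)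
      have "\<not> c - k < c - int M" "i = a" "0 \<le> k" "j + k = - i - 1"
        using d M[of "c - k"] by (auto simp: ijk delta_12_0_def in_12_def prod_12_def binom_coeff_def
            minus_prod_def split: if_splits)
      then show "d \<in> ?g ` {..M}"
        by (intro image_eqI[of _ _ "nat k"]) (auto simp: ijk)
    qed
  qed simp
  also have "\<dots> = (\<Sum>k\<le>M. ?F (?g k))"
    by (subst sum.reindex) (auto simp: inj_on_def)
  finally show ?thesis
    by (simp add: delta_12_0_def binom_coeff_def in_12_def minus_prod_def algebra_simps)
qed

lemma (in vertex_operator_map) series_mult_delta_21_0:
  assumes M: "\<And>n. n < b - int M \<Longrightarrow> Y u w $$ n = 0"
  shows "series_mult scale delta_21_0 (in_12 (prod_21 Y u v w)) (a, b, c) =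
    scale ((- 1) powi (- a - 1)) (\<Sum>k\<le>M. scale ((- 1) ^ k * (of_int (- a - 1) gchoose k))
      (prod_21 Y u v w (b - int k, c + a + 1 + int k)))"
proof -
  let ?F = "\<lambda>d. scale (delta_21_0 d) (in_12 (prod_21 Y u v w) ((a, b, c) - d))"
  let ?g = "\<lambda>k. (a, int k, - a - 1 - int k)"
  have "series_mult scale delta_21_0 (in_12 (prod_21 Y u v w)) (a, b, c) = sum ?F (?g ` {..M})"
    unfolding series_mult_def
  proof (rule Sum_any.expand_superset)
    show "{d. ?F d \<noteq> 0} \<subseteq> ?g ` {..M}"
    proof
      fix d assume d: "d \<in> {d. ?F d \<noteq> 0}"
      obtain i j k where ijk: "d = (i, j, k)" by (cases d)
      have "\<not> b - j < b - int M" "i = a" "0 \<le> j" "k + j = - i - 1"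
        using d M[of "b - j"] by (auto simp: ijk delta_21_0_def in_12_def prod_21_def binom_coeff_def
            minus_prod_def split: if_splits)
      then show "d \<in> ?g ` {..M}"
        by (intro image_eqI[of _ _ "nat j"]) (auto simp: ijk)
    qed
  qed simp
  also have "\<dots> = (\<Sum>k\<le>M. ?F (?g k))"
    by (subst sum.reindex) (auto simp: inj_on_def)
  finally show ?thesis
    by (simp add: delta_21_0_def binom_coeff_def in_12_def minus_prod_def scale_sum_right algebra_simps)
qed

lemma (in vertex_operator_map) series_mult_delta_10_2:
  assumes M: "\<And>n. n < a - int M \<Longrightarrow> Y u v $$ n = 0"
  shows "series_mult scale delta_10_2 (in_02 (iter_02 Y u v w)) (a, b, c) =
    (\<Sum>k\<le>M. scale ((- 1) ^ k * (of_int (- b - 1) gchoose k))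
      (scale ((- 1) ^ k) (iter_02 Y u v w (a - int k, c + b + 1 + int k))))"
proof -
  let ?F = "\<lambda>d. scale (delta_10_2 d) (in_02 (iter_02 Y u v w) ((a, b, c) - d))"
  let ?g = "\<lambda>k. (int k, b, - b - int k - 1)"
  have neg: "of_int (- b - 1) gchoose k = (- 1) ^ k * (of_int (b + int k) gchoose k :: complex)" for k
    by (subst gbinomial_negated_upper) (simp add: algebra_simps)
  have "series_mult scale delta_10_2 (in_02 (iter_02 Y u v w)) (a, b, c) = sum ?F (?g ` {..M})"
    unfolding series_mult_def
  proof (rule Sum_any.expand_superset)
    show "{d. ?F d \<noteq> 0} \<subseteq> ?g ` {..M}"
    proof
      fix d assume d: "d \<in> {d. ?F d \<noteq> 0}"
      obtain i j k where ijk: "d = (i, j, k)" by (cases d)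
      have "\<not> a - i < a - int M" "j = b" "0 \<le> i" "j + i = - k - 1"
        using d M[of "a - i"] by (auto simp: ijk delta_10_2_def in_02_def iter_02_def binom_coeff_def
            minus_prod_def split: if_splits)
      then show "d \<in> ?g ` {..M}"
        by (intro image_eqI[of _ _ "nat i"]) (auto simp: ijk)
    qed
  qed simp
  also have "\<dots> = (\<Sum>k\<le>M. ?F (?g k))"
    by (subst sum.reindex) (auto simp: inj_on_def)
  also have "\<dots> = (\<Sum>k\<le>M. scale ((- 1) ^ k * (of_int (- b - 1) gchoose k))
      (scale ((- 1) ^ k) (iter_02 Y u v w (a - int k, c + b + 1 + int k))))"
    unfolding neg
    by (intro sum.cong refl)
       (simp add: delta_10_2_def binom_coeff_def in_02_def minus_prod_def algebra_simps
         flip: power_mult_distrib)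
  finally show ?thesis .
qed

text \<open>
  The identity \<open>(1 - z)\<^sup>x\<^sup>+\<^sup>1 = (1 - z)\<^sup>x - z (1 - z)\<^sup>x\<close>, truncated and with \<open>p k\<close> in the place
  of \<open>z\<^sup>k\<close>.
\<close>

lemma (in vertex_operator_map) sum_scale_gbinomial_Pascal:
  "(\<Sum>k\<le>Suc M. scale ((- 1) ^ k * (x + 1 gchoose k)) (p k)) =
    (\<Sum>k\<le>Suc M. scale ((- 1) ^ k * (x gchoose k)) (p k))
    - (\<Sum>k\<le>M. scale ((- 1) ^ k * (x gchoose k)) (p (Suc k)))"
  unfolding sum.atMost_Suc_shift gbinomial_Suc_Suc
  by (simp add: algebra_simps sum.distrib sum_negf sum_subtractf)

section \<open>Weak associativity and the Jacobi identity\<close>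

context polynomially_commuting_map
begin

lemma fls_common_lower_bound: "\<exists>M. \<forall>i\<le>l. \<forall>n < c i - int M. (F :: nat \<Rightarrow> 'v fls) i $$ n = 0"
proof (induction l)
  case 0
  obtain N where "\<forall>n<N. F 0 $$ n = 0" by (rule fls_nth_vanishes_belowE)
  then show ?case by (intro exI[of _ "nat (c 0 - N)"]) auto
next
  case (Suc l)
  then obtain M where M: "\<forall>i\<le>l. \<forall>n < c i - int M. F i $$ n = 0" by blast
  obtain N where "\<forall>n<N. F (Suc l) $$ n = 0" by (rule fls_nth_vanishes_belowE)
  with M show ?case by (intro exI[of _ "max M (nat (c (Suc l) - N))"]) (auto simp: le_Suc_eq)
qed

text \<open>
  The left-hand side is the coefficient of \<open>x\<^sub>0\<^sup>a x\<^sub>2\<^sup>c\<close> in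
  \<open>(x\<^sub>0 + x\<^sub>2)\<^sup>l Y(u, x\<^sub>0 + x\<^sub>2) Y(v, x\<^sub>2) w\<close>, which is the coefficient of \<open>x\<^sub>1\<^sup>-\<^sup>1\<^sup>-\<^sup>l\<close> in
  \<open>x\<^sub>0\<^sup>-\<^sup>1 \<delta>((x\<^sub>1 - x\<^sub>2) / x\<^sub>0) Y(u, x\<^sub>1) Y(v, x\<^sub>2) w\<close>. Writing
  \<open>Y(v, x\<^sub>2) w = exp (x\<^sub>2 D) Y(w, - x\<^sub>2) v\<close> and moving the exponential to the left turns it into
  \<open>exp (x\<^sub>2 D)\<close> applied to \<open>(x\<^sub>0 + x\<^sub>2)\<^sup>l Y(u, x\<^sub>0) Y(w, - x\<^sub>2) v\<close>. In \<open>mult_diff\<close> the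
  variables stand for \<open>x\<^sub>0\<close> and \<open>- x\<^sub>2\<close>.
\<close>

lemma product_side_expansion:
  assumes Mw: "\<And>n. n < c - int M \<Longrightarrow> Y w v $$ n = 0" and l: "l \<le> M"
  shows "(\<Sum>k\<le>M. scale ((- 1) ^ k * (of_int (- a - 1) gchoose k))
      (prod_12 Y u v w (a - int l + int k, c - int k))) =
    (\<Sum>s\<le>M. scale ((- 1) powi (c - int s))
      (divided_D s ((mult_diff ^^ l) (Y12 u w v) a (c - int s))))"
proof -
  define X where "X s q = divided_D s (prod_12 Y u w v (a - int l + q, c - int s - q))" for s :: nat and q
  have X0: "X s q = 0" if "int M - int s < q" for s q
    using that Mw[of "c - int s - q"] by (simp add: X_def prod_12_def)
  define G where "G k s q = scale ((- 1) powi (c - int s) *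
    ((of_int (- a - 1) gchoose k) * binomial_int (a - int l + q) (q - int k))) (X s q)" for k s :: nat and q
  \<comment> \<open>Skew symmetry produces \<open>D\<^sup>j\<close>, of which conjugation leaves \<open>D\<^sup>s\<close>;
    the coefficient of \<open>X s q\<close> is collected with \<open>q = k + j - s\<close>.\<close>
  have "scale ((- 1) ^ k * (of_int (- a - 1) gchoose k)) (prod_12 Y u v w (a - int l + int k, c - int k)) =
      (\<Sum>j\<le>M. \<Sum>s\<le>M. G k s (int k + int j - int s))" for k
  proof -
    let ?e = "(- 1) ^ k * (of_int (- a - 1) gchoose k) :: complex"
    have "Y v w $$ (c - int k) = (\<Sum>j\<le>M. scale ((- 1) powi (c - int k - int j))
        (divided_D j (Y w v $$ (c - int k - int j))))"
      by (rule skew_symmetry) (simp add: Mw)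
    then have "scale ?e (prod_12 Y u v w (a - int l + int k, c - int k)) =
        (\<Sum>j\<le>M. scale ?e (scale ((- 1) powi (c - int k - int j))
          (Y u (divided_D j (Y w v $$ (c - int k - int j))) $$ (a - int l + int k))))"
      by (simp only: prod_12_def prod.case Y_sum Y_linear_simps scale_sum_right)
    also have "\<dots> = (\<Sum>j\<le>M. \<Sum>s\<le>M. G k s (int k + int j - int s))"
    proof (rule sum.cong[OF refl])
      fix j assume "j \<in> {..M}"
      then have j: "j \<le> M" by simp
      show "scale ?e (scale ((- 1) powi (c - int k - int j))
          (Y u (divided_D j (Y w v $$ (c - int k - int j))) $$ (a - int l + int k))) =
        (\<Sum>s\<le>M. G k s (int k + int j - int s))"
        unfolding Y_divided_D_padded[OF j] scale_sum_right
      proof (rule sum.cong[OF refl])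
        fix s :: nat
        have "(- 1) powi (c - int s) = (- 1) ^ k * (- 1) powi (c - int k - int j) * ((- 1 :: complex) powi (int j - int s))"
          by (simp flip: power_int_of_nat power_int_add)
        then show "scale ?e (scale ((- 1) powi (c - int k - int j))
            (scale ((- 1) powi (int j - int s) *
                binomial_int (a - int l + int k + int j - int s) (int j - int s))
              (divided_D s (Y u (Y w v $$ (c - int k - int j)) $$ (a - int l + int k + int j - int s))))) =
          G k s (int k + int j - int s)"
          by (simp add: G_def X_def prod_12_def algebra_simps)
      qed
    qed
    finally show ?thesis .
  qed
  then have "(\<Sum>k\<le>M. scale ((- 1) ^ k * (of_int (- a - 1) gchoose k))
      (prod_12 Y u v w (a - int l + int k, c - int k))) =
    (\<Sum>k\<le>M. \<Sum>j\<le>M. \<Sum>s\<le>M. G k s (int k + int j - int s))"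
    by simp
  also have "\<dots> = (\<Sum>k\<le>M. \<Sum>s\<le>M. \<Sum>j\<le>M. G k s (int k + int j - int s))"
    by (intro sum.cong[OF refl] sum.swap)
  also have "\<dots> = (\<Sum>k\<le>M. \<Sum>s\<le>M. \<Sum>q\<le>M. G k s (int q))"
  proof (rule sum.cong[OF refl], rule sum.cong[OF refl])
    fix k s
    have G0: "G k s q = 0" if "q < int k \<or> int M - int s < q" for q
      using that X0 by (auto simp: G_def binomial_int_def)
    have "(\<Sum>j\<le>M. G k s (int k + int j - int s)) =
        (\<Sum>j\<in>{j. j \<le> M \<and> s \<le> j \<and> k + j \<le> M + s}. G k s (int k + int j - int s))"
      by (rule sum.mono_neutral_right) (auto intro!: G0)
    also have "\<dots> = (\<Sum>q\<in>{q. q \<le> M \<and> k \<le> q \<and> q + s \<le> k + M}. G k s (int q))"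
      by (rule sum.reindex_bij_witness[of _ "\<lambda>q. q + s - k" "\<lambda>j. k + j - s"]) (auto simp: of_nat_diff)
    also have "\<dots> = (\<Sum>q\<le>M. G k s (int q))"
      by (rule sum.mono_neutral_left) (auto intro!: G0)
    finally show "(\<Sum>j\<le>M. G k s (int k + int j - int s)) = (\<Sum>q\<le>M. G k s (int q))" .
  qed
  also have "\<dots> = (\<Sum>s\<le>M. \<Sum>q\<le>M. \<Sum>k\<le>M. G k s (int q))"
    by (subst sum.swap, intro sum.cong[OF refl] sum.swap)
  also have "\<dots> = (\<Sum>s\<le>M. \<Sum>q\<le>M. scale ((- 1) powi (c - int s))
      (scale ((- 1) ^ q * of_nat (l choose q)) (X s (int q))))"
  proof (rule sum.cong[OF refl], rule sum.cong[OF refl])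
    fix s q assume "q \<in> {..M}"
    have "(\<Sum>k\<le>M. (of_int (- a - 1) gchoose k) * binomial_int (a - int l + int q) (int q - int k)) =
        (\<Sum>k\<in>{0..q}. (of_int (- a - 1) gchoose k) * (of_int (a - int l + int q) gchoose (q - k)))"
    proof -
      have "(\<Sum>k\<le>M. (of_int (- a - 1) gchoose k) * binomial_int (a - int l + int q) (int q - int k)) =
        (\<Sum>k\<in>{0..q}. (of_int (- a - 1) gchoose k) * binomial_int (a - int l + int q) (int q - int k))"
        using \<open>q \<in> {..M}\<close> by (intro sum.mono_neutral_right) (auto simp: binomial_int_def)
      also have "\<dots> = (\<Sum>k\<in>{0..q}. (of_int (- a - 1) gchoose k) * (of_int (a - int l + int q) gchoose (q - k)))"
        by (intro sum.cong refl) (auto simp: binomial_int_def nat_diff_distrib)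
      finally show ?thesis .
    qed
    also have "\<dots> = of_int (- a - 1) + of_int (a - int l + int q) gchoose q"
      by (rule gbinomial_Vandermonde)
    also have "\<dots> = of_int (- 1 - int l + int q) gchoose q"
      by (simp add: algebra_simps)
    also have "\<dots> = (- 1) ^ q * of_nat (l choose q)"
      by (rule binomial_int_negative)
    finally show "(\<Sum>k\<le>M. G k s (int q)) = scale ((- 1) powi (c - int s))
      (scale ((- 1) ^ q * of_nat (l choose q)) (X s (int q)))"
      unfolding G_def scale_sum_left[symmetric] sum_distrib_left[symmetric] by simp
  qed
  also have "\<dots> = (\<Sum>s\<le>M. scale ((- 1) powi (c - int s))
      (divided_D s ((mult_diff ^^ l) (Y12 u w v) a (c - int s))))"
  proof (rule sum.cong[OF refl])
    fix s
    have "(\<Sum>q\<le>M. scale ((- 1) ^ q * of_nat (l choose q)) (X s (int q))) =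
        (\<Sum>q\<le>l. scale ((- 1) ^ q * of_nat (l choose q)) (X s (int q)))"
      using l by (intro sum.mono_neutral_right) (auto simp: binomial_eq_0)
    also have "\<dots> = divided_D s ((mult_diff ^^ l) (Y12 u w v) a (c - int s))"
      by (simp add: mult_diff_funpow divided_D_sum divided_D_scale X_def)
    finally show "(\<Sum>q\<le>M. scale ((- 1) powi (c - int s)) (scale ((- 1) ^ q * of_nat (l choose q)) (X s (int q)))) =
        scale ((- 1) powi (c - int s)) (divided_D s ((mult_diff ^^ l) (Y12 u w v) a (c - int s)))"
      by (simp only: scale_sum_right[symmetric])
  qed
  finally show ?thesis .
qed

text \<open>
  The corresponding expansion of the coefficient of \<open>x\<^sub>0\<^sup>a x\<^sub>2\<^sup>c\<close> in
  \<open>(x\<^sub>0 + x\<^sub>2)\<^sup>l Y(Y(u, x\<^sub>0) v, x\<^sub>2) w\<close>, obtained from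
  \<open>Y(Y(u, x\<^sub>0) v, x\<^sub>2) w = exp (x\<^sub>2 D) Y(w, - x\<^sub>2) Y(u, x\<^sub>0) v\<close>.
\<close>

lemma iterate_side_expansion:
  assumes M: "\<And>i n. i \<le> l \<Longrightarrow> n < c - int l + int i - int M \<Longrightarrow> Y w (Y u v $$ (a - int i)) $$ n = 0"
  shows "(\<Sum>i\<le>l. scale (of_nat (l choose i)) (iter_02 Y u v w (a - int i, c - int l + int i))) =
    (\<Sum>s\<le>M. scale ((- 1) powi (c - int s))
      (divided_D s ((mult_diff ^^ l) (Y21 u w v) a (c - int s))))"
proof -
  define Z where "Z s i = divided_D s (prod_21 Y u w v (a - int i, c - int s - int l + int i))" for s i :: nat
  have "scale (of_nat (l choose i)) (iter_02 Y u v w (a - int i, c - int l + int i)) =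
      (\<Sum>s\<le>M. scale ((- 1) powi (c - int s)) (scale ((- 1) ^ (l - i) * of_nat (l choose i)) (Z s i)))"
    if "i \<le> l" for i
  proof -
    have "iter_02 Y u v w (a - int i, c - int l + int i) =
        (\<Sum>s\<le>M. scale ((- 1) powi (c - int l + int i - int s))
          (divided_D s (Y w (Y u v $$ (a - int i)) $$ (c - int l + int i - int s))))"
      unfolding iter_02_def prod.case by (rule skew_symmetry) (use M that in auto)
    also have "\<dots> = (\<Sum>s\<le>M. scale ((- 1) powi (c - int s)) (scale ((- 1) ^ (l - i)) (Z s i)))"
    proof (rule sum.cong[OF refl])
      fix s :: nat
      have "c - int l + int i - int s = (c - int s) - int (l - i)" using that by (simp add: of_nat_diff)
      then have "(- 1 :: complex) powi (c - int l + int i - int s) = (- 1) powi (c - int s) * (- 1) ^ (l - i)"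
        by (simp only: neg_one_powi_eq_power)
      then show "scale ((- 1) powi (c - int l + int i - int s))
          (divided_D s (Y w (Y u v $$ (a - int i)) $$ (c - int l + int i - int s))) =
        scale ((- 1) powi (c - int s)) (scale ((- 1) ^ (l - i)) (Z s i))"
        by (simp add: Z_def prod_21_def algebra_simps)
    qed
    finally show ?thesis by (simp add: scale_sum_right mult_ac)
  qed
  then have "(\<Sum>i\<le>l. scale (of_nat (l choose i)) (iter_02 Y u v w (a - int i, c - int l + int i))) =
      (\<Sum>i\<le>l. \<Sum>s\<le>M. scale ((- 1) powi (c - int s)) (scale ((- 1) ^ (l - i) * of_nat (l choose i)) (Z s i)))"
    by simp
  also have "\<dots> = (\<Sum>s\<le>M. scale ((- 1) powi (c - int s))
      (\<Sum>i\<le>l. scale ((- 1) ^ (l - i) * of_nat (l choose i)) (Z s i)))"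
    by (subst sum.swap) (simp only: scale_sum_right)
  also have "\<dots> = (\<Sum>s\<le>M. scale ((- 1) powi (c - int s))
      (divided_D s ((mult_diff ^^ l) (Y21 u w v) a (c - int s))))"
  proof (rule sum.cong[OF refl])
    fix s
    have "(\<Sum>i\<le>l. scale ((- 1) ^ (l - i) * of_nat (l choose i)) (Z s i)) =
        (\<Sum>j\<le>l. scale ((- 1) ^ j * of_nat (l choose j))
          (divided_D s (prod_21 Y u w v (a - int l + int j, c - int s - int j))))"
      by (rule sum.reindex_bij_witness[of _ "\<lambda>j. l - j" "\<lambda>i. l - i"])
         (auto simp: Z_def of_nat_diff binomial_symmetric[symmetric] algebra_simps)
    also have "\<dots> = divided_D s ((mult_diff ^^ l) (Y21 u w v) a (c - int s))"
      by (simp add: mult_diff_funpow divided_D_sum divided_D_scale)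
    finally show "scale ((- 1) powi (c - int s)) (\<Sum>i\<le>l. scale ((- 1) ^ (l - i) * of_nat (l choose i)) (Z s i)) =
        scale ((- 1) powi (c - int s)) (divided_D s ((mult_diff ^^ l) (Y21 u w v) a (c - int s)))"
      by simp
  qed
  finally show ?thesis .
qed

text \<open>
  The coefficient of \<open>x\<^sub>0\<^sup>a x\<^sub>1\<^sup>b x\<^sub>2\<^sup>c\<close> in the difference of the two sides of the Jacobi
  identity, applied to \<open>w\<close>.
\<close>

definition jacobi_defect :: "'v \<Rightarrow> 'v \<Rightarrow> 'v \<Rightarrow> int \<Rightarrow> int \<Rightarrow> int \<Rightarrow> 'v" where
  "jacobi_defect u v w a b c =
      series_mult scale delta_12_0 (in_12 (prod_12 Y u v w)) (a, b, c)
    - series_mult scale delta_21_0 (in_12 (prod_21 Y u v w)) (a, b, c)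
    - series_mult scale delta_10_2 (in_02 (iter_02 Y u v w)) (a, b, c)"

lemma Y_vanishes_below:
  obtains M where "\<And>n. n < c - int M \<Longrightarrow> Y u v $$ n = 0"
proof -
  obtain N where "\<forall>n<N. Y u v $$ n = 0" by (rule fls_nth_vanishes_belowE)
  then show ?thesis by (intro that[of "nat (c - N)"]) (auto split: if_split_asm)
qed

text \<open>
  Weak associativity: for very negative \<open>b\<close> the term with \<open>Y(v, x\<^sub>2) Y(u, x\<^sub>1) w\<close> does not
  contribute, and the two remaining terms have the expansions above, which agree by locality
  of \<open>u\<close> and \<open>w\<close>.
\<close>

lemma jacobi_defect_eq_0_weak_associativity:
  obtains b0 where "\<And>a b c. b < b0 \<Longrightarrow> jacobi_defect u v w a b c = 0"
proof -
  obtain k where k: "\<And>x l. k \<le> l \<Longrightarrow> (mult_diff ^^ l) (Y12 u w x) = (mult_diff ^^ l) (Y21 u w x)"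
    by (rule locality[of u w]) (rule that)
  obtain N where N: "\<forall>n<N. Y u w $$ n = 0" by (rule fls_nth_vanishes_belowE)
  show ?thesis
  proof (rule that[of "min N (- int k)"])
    fix a b c assume b: "b < min N (- int k)"
    define l where "l = nat (- 1 - b)"
    have l: "b = - 1 - int l" "k \<le> l" using b by (auto simp: l_def)
    obtain M1 where M1: "\<And>n. n < c - int M1 \<Longrightarrow> Y v w $$ n = 0" by (rule Y_vanishes_below) (rule that)
    obtain M2 where M2: "\<And>n. n < c - int M2 \<Longrightarrow> Y w v $$ n = 0" by (rule Y_vanishes_below) (rule that)
    obtain M3 where M3: "\<forall>i\<le>l. \<forall>n < c - int l + int i - int M3. Y w (Y u v $$ (a - int i)) $$ n = 0"
      using fls_common_lower_bound[of l "\<lambda>i. c - int l + int i" "\<lambda>i. Y w (Y u v $$ (a - int i))"]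
      by blast
    obtain M4 where M4: "\<And>n. n < a - int M4 \<Longrightarrow> Y u v $$ n = 0" by (rule Y_vanishes_below) (rule that)
    define M where "M = Max {M1, M2, M3, M4, l}"
    have M: "M1 \<le> M" "M2 \<le> M" "M3 \<le> M" "M4 \<le> M" "l \<le> M" by (auto simp: M_def)
    have "series_mult scale delta_12_0 (in_12 (prod_12 Y u v w)) (a, b, c) =
        (\<Sum>k\<le>M. scale ((- 1) ^ k * (of_int (- a - 1) gchoose k))
          (prod_12 Y u v w (b + a + 1 + int k, c - int k)))"
      using M by (intro series_mult_delta_12_0 M1) simp
    also have "\<dots> = (\<Sum>k\<le>M. scale ((- 1) ^ k * (of_int (- a - 1) gchoose k))
          (prod_12 Y u v w (a - int l + int k, c - int k)))"
      by (simp add: l(1))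
    also have "\<dots> = (\<Sum>s\<le>M. scale ((- 1) powi (c - int s))
      (divided_D s ((mult_diff ^^ l) (Y12 u w v) a (c - int s))))"
      using M by (intro product_side_expansion M2) simp_all
    also have "\<dots> = (\<Sum>s\<le>M. scale ((- 1) powi (c - int s))
      (divided_D s ((mult_diff ^^ l) (Y21 u w v) a (c - int s))))"
      using k[OF l(2)] by simp
    also have "\<dots> = (\<Sum>i\<le>l. scale (of_nat (l choose i)) (iter_02 Y u v w (a - int i, c - int l + int i)))"
      using M M3 by (intro iterate_side_expansion[symmetric]) auto
    also have "\<dots> = (\<Sum>i\<le>M. scale ((- 1) ^ i * (of_int (- b - 1) gchoose i))
        (scale ((- 1) ^ i) (iter_02 Y u v w (a - int i, c + b + 1 + int i))))"
    proof (rule sum.mono_neutral_cong_left)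
      fix i
      show "scale (of_nat (l choose i)) (iter_02 Y u v w (a - int i, c - int l + int i)) =
          scale ((- 1) ^ i * (of_int (- b - 1) gchoose i))
            (scale ((- 1) ^ i) (iter_02 Y u v w (a - int i, c + b + 1 + int i)))"
        by (simp add: l(1) binomial_gbinomial flip: power_mult_distrib)
    qed (use M in \<open>auto simp: l(1) binomial_gbinomial[symmetric]\<close>)
    also have "\<dots> = series_mult scale delta_10_2 (in_02 (iter_02 Y u v w)) (a, b, c)"
      using M by (intro series_mult_delta_10_2[symmetric] M4) simp
    finally have "series_mult scale delta_12_0 (in_12 (prod_12 Y u v w)) (a, b, c) =
      series_mult scale delta_10_2 (in_02 (iter_02 Y u v w)) (a, b, c)" .
    moreover have "series_mult scale delta_21_0 (in_12 (prod_21 Y u v w)) (a, b, c) = 0"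
      using N b by (subst series_mult_delta_21_0[where M = 0]) (auto simp: prod_21_def)
    ultimately show "jacobi_defect u v w a b c = 0" by (simp add: jacobi_defect_def)
  qed
qed

text \<open>
  For very negative \<open>a\<close> the iterate term vanishes, and the coefficient of \<open>x\<^sub>0\<^sup>a\<close> in the other
  two is \<open>(x\<^sub>1 - x\<^sub>2)\<^sup>-\<^sup>a\<^sup>-\<^sup>1 [Y(u, x\<^sub>1), Y(v, x\<^sub>2)] w = 0\<close>.
\<close>

lemma jacobi_defect_eq_0_weak_commutativity:
  obtains a0 where "\<And>a b c. a < a0 \<Longrightarrow> jacobi_defect u v w a b c = 0"
proof -
  obtain k where k: "\<And>x l. k \<le> l \<Longrightarrow> (mult_diff ^^ l) (Y12 u v x) = (mult_diff ^^ l) (Y21 u v x)"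
    by (rule locality[of u v]) (rule that)
  obtain N where N: "\<forall>n<N. Y u v $$ n = 0" by (rule fls_nth_vanishes_belowE)
  show ?thesis
  proof (rule that[of "min N (- int k)"])
    fix a b c assume a: "a < min N (- int k)"
    define l where "l = nat (- 1 - a)"
    have l: "a = - 1 - int l" "k \<le> l" using a by (auto simp: l_def)
    obtain M1 where M1: "\<And>n. n < c - int M1 \<Longrightarrow> Y v w $$ n = 0" by (rule Y_vanishes_below) (rule that)
    obtain M2 where M2: "\<And>n. n < b - int M2 \<Longrightarrow> Y u w $$ n = 0" by (rule Y_vanishes_below) (rule that)
    define M where "M = Max {M1, M2, l}"
    have M: "M1 \<le> M" "M2 \<le> M" "l \<le> M" by (auto simp: M_def)
    have cut: "(\<Sum>k\<le>M. scale ((- 1) ^ k * (of_int (- a - 1) gchoose k)) (p k)) =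
        (\<Sum>k\<le>l. scale ((- 1) ^ k * of_nat (l choose k)) (p k))" for p :: "nat \<Rightarrow> 'v"
      by (rule sum.mono_neutral_cong_right) (use M in \<open>auto simp: l(1) binomial_gbinomial[symmetric]\<close>)
    have "series_mult scale delta_12_0 (in_12 (prod_12 Y u v w)) (a, b, c) =
        (\<Sum>k\<le>M. scale ((- 1) ^ k * (of_int (- a - 1) gchoose k))
          (prod_12 Y u v w (b + a + 1 + int k, c - int k)))"
      using M by (intro series_mult_delta_12_0 M1) simp
    also have "\<dots> = (mult_diff ^^ l) (Y12 u v w) b c"
      unfolding cut mult_diff_funpow by (simp add: l(1))
    finally have 1: "series_mult scale delta_12_0 (in_12 (prod_12 Y u v w)) (a, b, c) =
        (mult_diff ^^ l) (Y12 u v w) b c" .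
    have "series_mult scale delta_21_0 (in_12 (prod_21 Y u v w)) (a, b, c) =
        scale ((- 1) powi (- a - 1)) (\<Sum>k\<le>M. scale ((- 1) ^ k * (of_int (- a - 1) gchoose k))
          (prod_21 Y u v w (b - int k, c + a + 1 + int k)))"
      using M by (intro series_mult_delta_21_0 M2) simp
    also have "\<dots> = (\<Sum>k\<le>l. scale ((- 1) ^ (l - k) * of_nat (l choose k))
          (prod_21 Y u v w (b - int k, c - int l + int k)))"
      unfolding cut scale_sum_right
    proof (rule sum.cong[OF refl])
      fix k assume "k \<in> {..l}"
      then have "(- 1 :: complex) ^ (l - k) = (- 1) ^ l * (- 1) ^ k"
        by (simp add: uminus_power_if)
      then show "scale ((- 1) powi (- a - 1)) (scale ((- 1) ^ k * of_nat (l choose k))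
          (prod_21 Y u v w (b - int k, c + a + 1 + int k))) =
        scale ((- 1) ^ (l - k) * of_nat (l choose k)) (prod_21 Y u v w (b - int k, c - int l + int k))"
        by (simp add: l(1) mult.assoc)
    qed
    also have "\<dots> = (\<Sum>j\<le>l. scale ((- 1) ^ j * of_nat (l choose j))
          (prod_21 Y u v w (b - int l + int j, c - int j)))"
      by (rule sum.reindex_bij_witness[of _ "\<lambda>j. l - j" "\<lambda>i. l - i"])
         (auto simp: of_nat_diff binomial_symmetric[symmetric] algebra_simps)
    also have "\<dots> = (mult_diff ^^ l) (Y21 u v w) b c"
      unfolding mult_diff_funpow ..
    finally have 2: "series_mult scale delta_21_0 (in_12 (prod_21 Y u v w)) (a, b, c) =
        (mult_diff ^^ l) (Y21 u v w) b c" .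
    have "series_mult scale delta_10_2 (in_02 (iter_02 Y u v w)) (a, b, c) = 0"
      using N a by (subst series_mult_delta_10_2[where M = 0]) (auto simp: iter_02_def)
    then show "jacobi_defect u v w a b c = 0"
      by (simp add: jacobi_defect_def 1 2 k[OF l(2)])
  qed
qed

text \<open>
  Each of the three delta series is annihilated by \<open>x\<^sub>0 - x\<^sub>1 + x\<^sub>2\<close>.
\<close>

lemma jacobi_defect_recursion:
  "jacobi_defect u v w (a - 1) b c = jacobi_defect u v w a (b - 1) c - jacobi_defect u v w a b (c - 1)"
proof -
  obtain M1 where M1: "\<And>n. n < c - int M1 \<Longrightarrow> Y v w $$ n = 0" by (rule Y_vanishes_below) (rule that)
  obtain M2 where M2: "\<And>n. n < b - int M2 \<Longrightarrow> Y u w $$ n = 0" by (rule Y_vanishes_below) (rule that)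
  obtain M3 where M3: "\<And>n. n < a - int M3 \<Longrightarrow> Y u v $$ n = 0" by (rule Y_vanishes_below) (rule that)
  note Pascal_a = sum_scale_gbinomial_Pascal[where x = "of_int (- a - 1)"]
  note Pascal_b = sum_scale_gbinomial_Pascal[where x = "of_int (- b - 1)"]
  have "series_mult scale delta_12_0 (in_12 (prod_12 Y u v w)) (a - 1, b, c) =
      series_mult scale delta_12_0 (in_12 (prod_12 Y u v w)) (a, b - 1, c)
    - series_mult scale delta_12_0 (in_12 (prod_12 Y u v w)) (a, b, c - 1)"
    using Pascal_a[where M = M1 and p =  "\<lambda>k. prod_12 Y u v w (b + a + int k, c - int k)"]
    by (simp add: series_mult_delta_12_0[where c = c and M = "Suc M1"]
        series_mult_delta_12_0[where c = "c - 1" and M = M1] M1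
        algebra_simps del: sum.atMost_Suc)
  moreover have "series_mult scale delta_21_0 (in_12 (prod_21 Y u v w)) (a - 1, b, c) =
      series_mult scale delta_21_0 (in_12 (prod_21 Y u v w)) (a, b - 1, c)
    - series_mult scale delta_21_0 (in_12 (prod_21 Y u v w)) (a, b, c - 1)"
    using arg_cong[OF Pascal_a[where M = M2 and p = "\<lambda>k. prod_21 Y u v w (b - int k, c + a + int k)"],
        of "scale ((- 1) powi (- a))"]
    by (simp add: series_mult_delta_21_0[where b = b and M = "Suc M2"]
        series_mult_delta_21_0[where b = "b - 1" and M = M2] M2
        power_int_diff algebra_simps del: sum.atMost_Suc)
  moreover have "series_mult scale delta_10_2 (in_02 (iter_02 Y u v w)) (a - 1, b, c) =
      series_mult scale delta_10_2 (in_02 (iter_02 Y u v w)) (a, b - 1, c)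
    - series_mult scale delta_10_2 (in_02 (iter_02 Y u v w)) (a, b, c - 1)"
    using Pascal_b[where M = M3 and p = "\<lambda>k. scale ((- 1) ^ k) (iter_02 Y u v w (a - int k, c + b + int k))"]
    by (simp add: series_mult_delta_10_2[where a = a and M = "Suc M3"]
        series_mult_delta_10_2[where a = "a - 1" and M = M3] M3
        sum_negf algebra_simps del: sum.atMost_Suc)
  ultimately show ?thesis by (simp add: jacobi_defect_def)
qed

text \<open>
  Induction on \<open>b\<close>, and for each \<open>b\<close> on \<open>a\<close>: once the coefficients at \<open>b - 1\<close> vanish, the
  recursion reduces those at \<open>(a, b)\<close> to those at \<open>(a - 1, b)\<close>.
\<close>

lemma jacobi_defect_eq_0: "jacobi_defect u v w a b c = 0"
proof -
  obtain a0 where a0: "\<And>a b c. a < a0 \<Longrightarrow> jacobi_defect u v w a b c = 0"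
    by (rule jacobi_defect_eq_0_weak_commutativity) (rule that)
  obtain b0 where b0: "\<And>a b c. b < b0 \<Longrightarrow> jacobi_defect u v w a b c = 0"
    by (rule jacobi_defect_eq_0_weak_associativity) (rule that)
  have "\<forall>a c. jacobi_defect u v w a b c = 0" for b
  proof (induction "nat (b - b0)" arbitrary: b rule: less_induct)
    case (less b)
    have prev: "jacobi_defect u v w a (b - 1) c = 0" if "\<not> b < b0" for a c
    proof (cases "b - 1 < b0")
      case False
      then show ?thesis using less[of "b - 1"] by simp
    qed (simp add: b0)
    have "\<forall>c. jacobi_defect u v w a b c = 0" if "\<not> b < b0" for a
    proof (induction "nat (a - a0)" arbitrary: a rule: less_induct)
      case (less a)
      show ?case
      proof (cases "a < a0")
        case False
        have "jacobi_defect u v w (a - 1) b c = 0" for c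
        proof (cases "a - 1 < a0")
          case False
          then show ?thesis using less[of "a - 1"] by simp
        qed (simp add: a0)
        then have "jacobi_defect u v w a b (c - 1) = 0" for c
          using jacobi_defect_recursion[of u v w a b c] prev[OF that] by simp
        from this[of "c + 1" for c] show ?thesis by simp
      qed (simp add: a0)
    qed
    then show ?case using b0 by blast
  qed
  then show ?thesis by blast
qed

end

theorem proposition5p1:
  fixes scale :: "complex \<Rightarrow> 'v::ab_group_add \<Rightarrow> 'v"
    and Y :: "'v \<Rightarrow> 'v \<Rightarrow> 'v fls"
    and vac :: 'v
    and D :: "'v \<Rightarrow> 'v"
  assumes "vertex_operator_map scale Y"
    and "Vector_Spaces.linear scale scale D"
    and "D vac = 0"
    and "\<And>w. Y vac w = fls_const w"
    and "\<And>v. Y v vac \<in> range fps_to_fls"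
    and "\<And>v. Y v vac $$ 0 = v"
    and "\<And>v w. fls_map D (Y v w) - Y v (D w) = fls_ddx scale (Y v w)"
    and "\<And>u v. \<exists>f :: complex poly poly. f \<noteq> 0 \<and>
           (\<forall>w. series_mult scale (poly2_series f) (prod_12 Y u v w)
              = series_mult scale (poly2_series f) (prod_21 Y u v w))"
  shows "vertex_algebra scale Y vac"
proof -
  have "polynomially_commuting_map scale Y vac D"
    using assms
    unfolding polynomially_commuting_map_def polynomially_commuting_map_axioms_def by blast
  then interpret polynomially_commuting_map scale Y vac D .
  show ?thesis
  proof unfold_locales
    fix u v w :: 'v and e :: "int \<times> int \<times> int"
    obtain a b c where "e = (a, b, c)" by (cases e)
    then show "series_mult scale delta_12_0 (in_12 (prod_12 Y u v w)) e
        - series_mult scale delta_21_0 (in_12 (prod_21 Y u v w)) e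
        = series_mult scale delta_10_2 (in_02 (iter_02 Y u v w)) e"
      using jacobi_defect_eq_0[of u v w a b c] by (simp add: jacobi_defect_def)
  qed (fact Y_vac Y_creation Y_creation_limit)+
qed

end
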